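(* For any $K>0$, there exist probability distributions $\mathbb{P}_R$ and $\mathbb{P}_B$ on the positive reals, with finite means $\mu_R$ and $\mu_B$ respectively and at least one of them non-atomic, such that $\mu_R>K\mu_B$ and blue wins almost surely.
   Context: Colourings. A colouring of $\mathbb{R}$ into intervals is given by a doubly infinite sequence of boundary-points $(p_i)_{i\in\mathbb{Z}}$ with $p_i<p_j$ when $i<j$ and $\mathbb{R}=\bigcup_{i\in\mathbb{Z}}(p_i,p_{i+1}]$, where each $(p_{2i-1},p_{2i}]$ is coloured red and each $(p_{2i},p_{2i+1}]$ is coloured blue. Recolourings. A recolouring picks a monochromatic interval (between two consecutive current boundary-points) whose two neighbouring intervals (of the opposite colour) are both strictly longer, and changes its colour, so that these three consecutive intervals subsequently form a single monochromatic interval (its two endpoints cease to be boundary-points). A sequence of recolourings (finite, or infinite and indexed by $1,2,3,\dots$), performed successively starting from an initial colouring $\Delta$, is complete if whenever at some stage there is a monochromatic interval $I$ both of whose neighbours are longer, $I$ is recoloured at that or some later step. Random colouring. Let $(\mathcal{R}_i)_{i\in\mathbb{Z}}$ and $(\mathcal{B}_i)_{i\in\mathbb{Z}}$ be i.i.d. sequences, independent of each other, with distributions $\mathbb{P}_R$ and $\mathbb{P}_B$ respectively. $\Delta(\mathbb{P}_R,\mathbb{P}_B)$ is the colouring of the line into consecutive intervals $\dots,R_{-1},B_{-1},R_0,B_0,R_1,B_1,\dots$ (left to right), where $R_i$ is red of length $\mathcal{R}_i$, $B_i$ is blue of length $\mathcal{B}_i$, and the origin is the boundary-point between $R_0$ and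 $B_0$. A distribution is non-atomic if it has no atoms. Winning. Blue wins almost surely (for the pair $\mathbb{P}_R,\mathbb{P}_B$) if, almost surely, under any complete sequence of recolourings applied to $\Delta(\mathbb{P}_R,\mathbb{P}_B)$, every point of $\mathbb{R}$ changes colour only finitely many times and is finally blue. *)

theory Defs
  imports "HOL-Probability.Probability"
begin

section \<open>Colourings of the line into intervals\<close>

datatype colour = Red | Blue

primrec opposite :: "colour \<Rightarrow> colour" where
  "opposite Red = Blue"
| "opposite Blue = Red"

definition boundary_seq :: "(int \<Rightarrow> real) \<Rightarrow> bool" where
  "boundary_seq p \<longleftrightarrow> strict_mono p \<and> (\<Union>i. {p i<..p (i + 1)}) = UNIV"

text \<open>
  If \<open>p\<close> is a boundary sequence, the points not in any \<open>{p (2 * i)<..p (2 * i + 1)}\<close> are exactly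
  those of the intervals \<open>{p (2 * i - 1)<..p (2 * i)}\<close>.
\<close>

definition colouring_of :: "(int \<Rightarrow> real) \<Rightarrow> real \<Rightarrow> colour" where
  "colouring_of p x = (if \<exists>i. x \<in> {p (2 * i)<..p (2 * i + 1)} then Blue else Red)"

section \<open>Recolourings\<close>

text \<open>
  The state of the process is the colour function itself. It determines its boundary sequence up
  to a shift of the index by an even number, so the existential quantifier over \<open>p\<close> below just
  picks some indexing of the current boundary-points. After the colour of a recolourable interval
  is flipped, its two endpoints are no longer in the range of any boundary sequence of the result.
\<close>

definition recolourable :: "(real \<Rightarrow> colour) \<Rightarrow> real set \<Rightarrow> bool" where
  "recolourable c I \<longleftrightarrow>
     (\<exists>p i. boundary_seq p \<and> c = colouring_of p \<and> I = {p i<..p (i + 1)} \<and>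
            p (i + 1) - p i < p i - p (i - 1) \<and>
            p (i + 1) - p i < p (i + 2) - p (i + 1))"

definition recolour :: "real set \<Rightarrow> (real \<Rightarrow> colour) \<Rightarrow> real \<Rightarrow> colour" where
  "recolour I c x = (if x \<in> I then opposite (c x) else c x)"

primrec stage :: "(real \<Rightarrow> colour) \<Rightarrow> (nat \<Rightarrow> real set) \<Rightarrow> nat \<Rightarrow> real \<Rightarrow> colour" where
  "stage c J 0 = c"
| "stage c J (Suc n) = recolour (J n) (stage c J n)"

text \<open>
  A finite or infinite sequence of recolourings is given by its length \<open>N\<close> (infinite if
  \<open>N = \<infinity>\<close>) and the intervals \<open>J n\<close> with \<open>enat n < N\<close>; the other values of \<open>J\<close> are irrelevant.
  The interval \<open>J n\<close> is recoloured in the step from stage \<open>n\<close> to stage \<open>Suc n\<close>, so the stages that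
  occur are those with \<open>enat n \<le> N\<close>.
\<close>

definition recolouring_seq :: "(real \<Rightarrow> colour) \<Rightarrow> enat \<Rightarrow> (nat \<Rightarrow> real set) \<Rightarrow> bool" where
  "recolouring_seq c N J \<longleftrightarrow> (\<forall>n. enat n < N \<longrightarrow> recolourable (stage c J n) (J n))"

definition complete_recolouring_seq ::
  "(real \<Rightarrow> colour) \<Rightarrow> enat \<Rightarrow> (nat \<Rightarrow> real set) \<Rightarrow> bool" where
  "complete_recolouring_seq c N J \<longleftrightarrow>
     recolouring_seq c N J \<and>
     (\<forall>n I. enat n \<le> N \<longrightarrow> recolourable (stage c J n) I \<longrightarrow>
        (\<exists>m\<ge>n. enat m < N \<and> J m = I))"

definition finally_blue ::
  "(real \<Rightarrow> colour) \<Rightarrow> enat \<Rightarrow> (nat \<Rightarrow> real set) \<Rightarrow> real \<Rightarrow> bool" where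
  "finally_blue c N J x \<longleftrightarrow>
     finite {n. enat n < N \<and> stage c J (Suc n) x \<noteq> stage c J n x} \<and>
     (\<exists>n. enat n \<le> N \<and> (\<forall>m\<ge>n. enat m \<le> N \<longrightarrow> stage c J m x = Blue))"

section \<open>Random colourings\<close>

text \<open>
  Given the lengths \<open>r i\<close> of the red intervals and \<open>b i\<close> of the blue ones, \<open>gap r b k\<close> is the
  length of the interval from boundary-point \<open>k\<close> to boundary-point \<open>k + 1\<close>. Boundary-point \<open>0\<close> is
  the origin, with the red interval number \<open>0\<close> on its left and the blue one on its right.
\<close>

definition gap :: "(int \<Rightarrow> real) \<Rightarrow> (int \<Rightarrow> real) \<Rightarrow> int \<Rightarrow> real" where
  "gap r b k = (if even k then b (k div 2) else r ((k + 1) div 2))"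

definition boundaries :: "(int \<Rightarrow> real) \<Rightarrow> (int \<Rightarrow> real) \<Rightarrow> int \<Rightarrow> real" where
  "boundaries r b k =
     (if 0 \<le> k then (\<Sum>j\<in>{0..<k}. gap r b j) else - (\<Sum>j\<in>{k..<0}. gap r b j))"

definition distribution_on_positive_reals :: "real measure \<Rightarrow> bool" where
  "distribution_on_positive_reals P \<longleftrightarrow> real_distribution P \<and> (AE x in P. 0 < x)"

definition non_atomic :: "real measure \<Rightarrow> bool" where
  "non_atomic P \<longleftrightarrow> (\<forall>x. measure P {x} = 0)"

text \<open>
  The lengths are the coordinates of the product space, which makes them independent. For
  distributions on the positive reals, \<open>boundaries r b\<close> is almost surely a boundary sequence, so
  the values of \<open>colouring_of\<close> at other sequences do not matter.
\<close>

definition blue_wins_almost_surely :: "real measure \<Rightarrow> real measure \<Rightarrow> bool" where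
  "blue_wins_almost_surely P_R P_B \<longleftrightarrow>
     (AE (r, b) in (\<Pi>\<^sub>M i\<in>(UNIV :: int set). P_R) \<Otimes>\<^sub>M (\<Pi>\<^sub>M i\<in>(UNIV :: int set). P_B).
        \<forall>N J. complete_recolouring_seq (colouring_of (boundaries r b)) N J \<longrightarrow>
          (\<forall>x. finally_blue (colouring_of (boundaries r b)) N J x))"

end

theory Submission
  imports Defs
begin

text \<open>
  Blue intervals get length uniform in \<open>[1, 2]\<close>, red ones a discrete Pareto length: \<open>32 ^ k / 2 ^ 17\<close>
  with probability proportional to \<open>(\<theta> / 32) ^ k\<close>, where \<open>\<theta> < 1\<close>. Every \<open>k\<close> contributes a multiple
  of \<open>\<theta> ^ k\<close> to the mean red length, so the mean is of order \<open>1 / (1 - \<theta>)\<close> and can be made as large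
  as desired. Yet at each single scale red is rare: a stretch of about \<open>32 ^ n\<close> consecutive
  intervals contains a red one of length at least of order \<open>32 ^ n\<close> only with probability of order
  \<open>\<theta> ^ n\<close>, with a small constant factor that is uniform in \<open>\<theta>\<close>. Red has a huge mean only because it
  is spread over many scales, and blue wins at one scale after the other.

  To make this precise, red intervals are removed in rounds, as in the hierarchical islands used
  for sparse random sets. In round \<open>n\<close>, with \<open>a = 32 ^ n / 8\<close>, a group of surviving red intervals is
  an island if it lies within distance of order \<open>a\<close> of one of its members while all other survivors
  are at distance more than \<open>4 a\<close> from that member. Two facts carry the proof.

  Geometry (\<open>finally_blue_all\<close>). The convex hulls of the islands are nested or separated, and a
  gap between two separated hulls is at least as long as the hull of the lower round. Consequently
  no blue interval separating two maximal hulls can ever be recoloured, whatever the order of the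
  recolourings: it would have to be shorter than both its red neighbours, and these are confined to
  their hulls. So red never leaves the maximal hulls. If some red were left in the end, consider a
  hull of the lowest round that contains some of it. Around this hull there is blue on both
  sides over at least the length of the hull, so the shortest interval in the hull is shorter than
  both its neighbours, ties having probability zero. By completeness it must still be recoloured.

  Probability (\<open>survivors_witness\<close>, \<open>sum_weight_witnesses\<close>, \<open>AE_no_witness_near\<close>). A red interval that
  survives a round is very long for this round, is close to such an interval, or has another
  survivor at a distance so large that the two have survived for disjoint reasons. If
  \<open>u n\<close> bounds the sum of the probabilities of these reasons at a given site, and \<open>t n\<close> is the
  probability of a very long red interval, this gives a recursion \<open>u (n + 1) \<le> t (n + 1) + C 32 ^ n (u n)\<^sup>2\<close>,
  where the factor \<open>C 32 ^ n\<close> counts the possible positions of the second survivor. As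
  \<open>t n = (\<theta> / 32) ^ (n + 3)\<close> is small enough, \<open>u n \<le> 2 t n\<close> follows, and \<open>32 ^ n u n\<close> is summable. By
  Borel and Cantelli, almost surely every red interval is in only finitely many hulls, hence in
  a maximal one.
\<close>

section \<open>Boundary sequences and the jumps of a colouring\<close>

lemma boundary_seq_cell:
  assumes "boundary_seq p" obtains i where "p i < x" "x \<le> p (i + 1)"
proof -
  have "x \<in> (\<Union>i. {p i<..p (i + 1)})" using assms by (simp add: boundary_seq_def)
  then show ?thesis using that by auto
qed

lemma boundary_seq_less: "boundary_seq p \<Longrightarrow> p i < p j \<longleftrightarrow> i < j"
  by (simp add: boundary_seq_def strict_mono_less)

lemma boundary_seq_le: "boundary_seq p \<Longrightarrow> p i \<le> p j \<longleftrightarrow> i \<le> j"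
  by (simp add: boundary_seq_def strict_mono_less_eq)

lemma cell_unique:
  assumes "boundary_seq p" "p i < x" "x \<le> p (i + 1)" "p j < x" "x \<le> p (j + 1)"
  shows "i = j"
proof -
  have "p i < p (j + 1)" "p j < p (i + 1)" using assms(2-5) by linarith+
  then show ?thesis using boundary_seq_less[OF assms(1)] by simp
qed

lemma colouring_of_cell:
  assumes p: "boundary_seq p" and x: "p i < x" "x \<le> p (i + 1)"
  shows "colouring_of p x = (if even i then Blue else Red)"
proof -
  have "(\<exists>j. x \<in> {p (2 * j)<..p (2 * j + 1)}) \<longleftrightarrow> even i"
  proof
    assume "\<exists>j. x \<in> {p (2 * j)<..p (2 * j + 1)}"
    then obtain j where "p (2 * j) < x" "x \<le> p (2 * j + 1)" by auto
    then have "i = 2 * j" using cell_unique[OF p x] by blast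
    then show "even i" by simp
  next
    assume "even i"
    then obtain j where "i = 2 * j" by blast
    then show "\<exists>j. x \<in> {p (2 * j)<..p (2 * j + 1)}" using x by auto
  qed
  then show ?thesis by (simp add: colouring_of_def)
qed

text \<open>
  The boundary sequence of a colouring is determined only up to a shift of the index, and a
  recolouring may come with any choice of it. The set of boundary-points can be read off from the
  colouring itself, so invariants are stated in terms of this set.
\<close>

definition colour_jumps :: "(real \<Rightarrow> colour) \<Rightarrow> real set" where
  "colour_jumps c = {y. \<exists>e>0. \<forall>z. y < z \<and> z < y + e \<longrightarrow> c z \<noteq> c y}"

lemma colour_jumps_colouring_of:
  assumes p: "boundary_seq p"
  shows "colour_jumps (colouring_of p) = range p"
proof (intro equalityI subsetI)
  fix y assume "y \<in> range p"
  then obtain i where y: "y = p i" by auto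
  have c: "p (i - 1) < y" "p i < p (i + 1)" using boundary_seq_less[OF p] y by auto
  have cy: "colouring_of p y = (if even (i - 1) then Blue else Red)"
    using c by (intro colouring_of_cell[OF p]) (auto simp: y)
  have "colouring_of p z \<noteq> colouring_of p y" if "y < z" "z < y + (p (i + 1) - p i)" for z
  proof -
    have "colouring_of p z = (if even i then Blue else Red)"
      using that by (intro colouring_of_cell[OF p]) (auto simp: y)
    then show ?thesis using cy by auto
  qed
  then show "y \<in> colour_jumps (colouring_of p)"
    unfolding colour_jumps_def using c(2) by (intro CollectI exI[of _ "p (i + 1) - p i"]) auto
next
  fix y assume "y \<in> colour_jumps (colouring_of p)"
  then obtain e where e: "e > 0"
    "\<And>z. y < z \<Longrightarrow> z < y + e \<Longrightarrow> colouring_of p z \<noteq> colouring_of p y"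
    by (auto simp: colour_jumps_def)
  obtain i where i: "p i < y" "y \<le> p (i + 1)" using boundary_seq_cell[OF p] .
  show "y \<in> range p"
  proof (cases "y = p (i + 1)")
    case False
    then have "y < min (y + e) (p (i + 1))" using i e by auto
    then obtain z where z: "y < z" "z < min (y + e) (p (i + 1))" using dense by blast
    have "colouring_of p z = colouring_of p y"
      using colouring_of_cell[OF p i] colouring_of_cell[OF p, of i z] z i by simp
    then show ?thesis using e(2)[of z] z by simp
  qed auto
qed

lemma boundary_seq_locally_finite:
  assumes p: "boundary_seq p" shows "finite (range p \<inter> {s..t})"
proof -
  obtain i j where i: "p i < s" and j: "t \<le> p (j + 1)"
    using boundary_seq_cell[OF p] by metis
  have "range p \<inter> {s..t} \<subseteq> p ` {i..j+1}"
  proof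
    fix y assume "y \<in> range p \<inter> {s..t}"
    then obtain k where k: "y = p k" "s \<le> p k" "p k \<le> t" by auto
    then have "p i < p k" "p k \<le> p (j + 1)" using i j by linarith+
    then have "i < k" "k \<le> j + 1" using boundary_seq_less[OF p] boundary_seq_le[OF p] by auto
    then show "y \<in> p ` {i..j+1}" using k by auto
  qed
  then show ?thesis using finite_subset by blast
qed

text \<open>
  Recolouring the interval from \<open>p i\<close> to \<open>p (i + 1)\<close> deletes these two points from the sequence. The
  points that follow keep the parity of their index, so the colours of the other intervals persist.
\<close>

lemma
  fixes i :: int
  assumes p: "boundary_seq p"
  defines "q \<equiv> \<lambda>j. if j < i then p j else p (j + 2)"
  shows boundary_seq_merge: "boundary_seq q"
    and recolour_eq_merge: "recolour {p i<..p (i + 1)} (colouring_of p) = colouring_of q"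
    and range_merge: "range q = range p - {p i, p (i + 1)}"
proof -
  have cell: "\<exists>j. q j < x \<and> x \<le> q (j + 1) \<and>
      (if even j then Blue else Red) = recolour {p i<..p (i + 1)} (colouring_of p) x" for x
  proof -
    obtain k where k: "p k < x" "x \<le> p (k + 1)" using boundary_seq_cell[OF p] .
    have ck: "colouring_of p x = (if even k then Blue else Red)" by (rule colouring_of_cell[OF p k])
    have ii: "recolour {p i<..p (i + 1)} (colouring_of p) x =
        (if k = i then opposite (if even k then Blue else Red) else if even k then Blue else Red)"
    proof (cases "k = i")
      case True
      then show ?thesis using k ck by (simp add: recolour_def)
    next
      case False
      then have "x \<notin> {p i<..p (i + 1)}" using cell_unique[OF p k] by (metis greaterThanAtMost_iff)
      then show ?thesis using False ck by (simp add: recolour_def)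
    qed
    consider "k < i - 1" | "k = i - 1 \<or> k = i \<or> k = i + 1" | "k > i + 1" by linarith
    then show ?thesis
    proof cases
      case 1
      then show ?thesis using k unfolding ii by (intro exI[of _ k]) (simp add: q_def)
    next
      case 2
      have "p (i - 1) \<le> p k" "p (k + 1) \<le> p (i + 2)"
        using 2 boundary_seq_le[OF p] by auto
      then have "q (i - 1) < x" "x \<le> q (i - 1 + 1)" using k by (simp_all add: q_def)
      moreover have "(if even (i - 1) then Blue else Red) =
          recolour {p i<..p (i + 1)} (colouring_of p) x"
        using 2 unfolding ii by auto
      ultimately show ?thesis by blast
    next
      case 3
      have "k - 2 + 1 + 2 = k + 1" by simp
      then have "q (k - 2) < x" "x \<le> q (k - 2 + 1)" using 3 k by (simp_all add: q_def add.commute)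
      moreover have "(if even (k - 2) then Blue else Red) =
          recolour {p i<..p (i + 1)} (colouring_of p) x"
        using 3 unfolding ii by simp
      ultimately show ?thesis by blast
    qed
  qed
  show q: "boundary_seq q"
    unfolding boundary_seq_def
  proof
    show "strict_mono q"
      using boundary_seq_less[OF p] by (auto simp: strict_mono_def q_def)
    show "(\<Union>i. {q i<..q (i + 1)}) = UNIV"
    proof -
      have "\<exists>j. q j < x \<and> x \<le> q (j + 1)" for x using cell[of x] by blast
      then show ?thesis by (auto simp: set_eq_iff)
    qed
  qed
  show "recolour {p i<..p (i + 1)} (colouring_of p) = colouring_of q"
  proof
    fix x
    obtain j where j: "q j < x" "x \<le> q (j + 1)"
      "(if even j then Blue else Red) = recolour {p i<..p (i + 1)} (colouring_of p) x"
      using cell[of x] by blast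
    then show "recolour {p i<..p (i + 1)} (colouring_of p) x = colouring_of q x"
      using colouring_of_cell[OF q j(1,2)] by simp
  qed
  have inj: "p a = p b \<longleftrightarrow> a = b" for a b
    using p by (simp add: boundary_seq_def strict_mono_eq)
  show "range q = range p - {p i, p (i + 1)}"
  proof (intro equalityI subsetI)
    fix y assume "y \<in> range p - {p i, p (i + 1)}"
    then obtain k where k: "y = p k" "k \<noteq> i" "k \<noteq> i + 1" by auto
    then have "y = q (if k < i then k else k - 2)" by (auto simp: q_def)
    then show "y \<in> range q" by blast
  qed (auto simp: q_def inj split: if_splits)
qed

section \<open>Confining red to isolated hulls\<close>

text \<open>
  An element \<open>(n, l, h)\<close> of \<open>H\<close> is the interval from \<open>l\<close> to \<open>h\<close> with a rank \<open>n\<close>. Different elements may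
  describe the same interval; otherwise the distance between two of them is at least the length of
  the one of lower rank. The rank serves to choose a hull that no shorter gap can
  separate from another one; a hull of minimal length need not exist.
\<close>

locale isolated_hulls =
  fixes P :: "int \<Rightarrow> real" and H :: "(nat \<times> real \<times> real) set"
  assumes P: "boundary_seq P"
    and no_ties: "\<And>i j k. i < j \<Longrightarrow> j < k \<Longrightarrow> P j - P i \<noteq> P k - P j"
    and hull_less: "\<And>n l h. (n, l, h) \<in> H \<Longrightarrow> l < h"
    and hull_isolated: "\<And>n l h m l' h'. (n, l, h) \<in> H \<Longrightarrow> (m, l', h') \<in> H \<Longrightarrow> n \<le> m \<Longrightarrow>
           l = l' \<and> h = h' \<or> h - l \<le> l' - h \<or> h - l \<le> l - h'"
    and hull_cover: "\<And>i. \<exists>n l h. (n, l, h) \<in> H \<and> l \<le> P (2 * i - 1) \<and> P (2 * i) \<le> h"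
begin

definition confined :: "(real \<Rightarrow> colour) \<Rightarrow> bool" where
  "confined c \<longleftrightarrow> (\<exists>p. boundary_seq p \<and> c = colouring_of p) \<and> colour_jumps c \<subseteq> range P \<and>
     (\<forall>x. c x = Red \<longrightarrow> (\<exists>n l h. (n, l, h) \<in> H \<and> l < x \<and> x \<le> h))"

lemma hull_unique:
  assumes "(n, l, h) \<in> H" "(m, l', h') \<in> H" "l < x" "x \<le> h" "l' < x" "x \<le> h'"
  shows "l = l' \<and> h = h'"
  using hull_isolated[OF assms(1,2)] hull_isolated[OF assms(2,1)] hull_less[OF assms(1)]
    hull_less[OF assms(2)] assms(3-6)
  by (cases "n \<le> m") auto

text \<open>
  Otherwise a red point on the edge of one hull would be in a second hull, although there is a
  gap between the two.
\<close>

lemma red_interval_in_hull: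
  assumes c: "confined c" and red: "\<And>z. u < z \<Longrightarrow> z \<le> v \<Longrightarrow> c z = Red"
    and H: "(n, l, h) \<in> H" "l < x" "x \<le> h" and x: "u < x" "x \<le> v"
  shows "l \<le> u \<and> v \<le> h"
proof -
  have left: "l \<le> u" if H: "(n, l, h) \<in> H" "l < x" "x \<le> h" and x: "u < x" "x \<le> v" for n l h x
  proof (rule ccontr)
    assume "\<not> l \<le> u"
    then have "c l = Red" using red that by auto
    then obtain n' l' h' where H': "(n', l', h') \<in> H" "l' < l" "l \<le> h'"
      using c unfolding confined_def by blast
    then show False
      using hull_isolated[OF H(1) H'(1)] hull_isolated[OF H'(1) H(1)] hull_less[OF H(1)]
        hull_less[OF H'(1)] by (cases "n \<le> n'") auto
  qed
  have "c v = Red" using red x by auto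
  then obtain n' l' h' where H': "(n', l', h') \<in> H" "l' < v" "v \<le> h'"
    using c unfolding confined_def by blast
  have "l' \<le> u" using left[OF H'] x by auto
  then have "h = h'" using hull_unique[OF H(1) H'(1) H(2,3)] H'(3) x by auto
  then show ?thesis using left[OF H x] H' by auto
qed

lemma red_interval_hull:
  assumes c: "confined c" and "u < v" and red: "\<And>z. u < z \<Longrightarrow> z \<le> v \<Longrightarrow> c z = Red"
  obtains n l h where "(n, l, h) \<in> H" "l \<le> u" "v \<le> h"
proof -
  have "c v = Red" using red assms(2) by auto
  then obtain n l h where *: "(n, l, h) \<in> H" "l < v" "v \<le> h"
    using c unfolding confined_def by blast
  then have "l \<le> u \<and> v \<le> h" using red_interval_in_hull[OF c red *(1) *(2,3) assms(2)] by auto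
  then show ?thesis using that[OF *(1)] by auto
qed

text \<open>
  The key invariance. If a blue interval is recoloured, its red neighbours must lie in the same hull:
  if they were in different hulls, the blue interval would cover the gap between them, which is at
  least as long as one of the two hulls, hence at least as long as one of the two neighbours.
\<close>

lemma recolour_confined:
  assumes c: "confined c" and I: "recolourable c I"
  obtains u v n l h where "I = {u<..v}" "u < v" "(n, l, h) \<in> H" "l \<le> u" "v \<le> h"
    "u \<in> colour_jumps c" "v \<in> colour_jumps c"
    "colour_jumps (recolour I c) = colour_jumps c - {u, v}" "confined (recolour I c)"
proof -
  obtain p i where p: "boundary_seq p" and cp: "c = colouring_of p" and I: "I = {p i<..p (i + 1)}"
    and short: "p (i + 1) - p i < p i - p (i - 1)" "p (i + 1) - p i < p (i + 2) - p (i + 1)"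
    using I unfolding recolourable_def by blast
  note less = boundary_seq_less[OF p] and cell = colouring_of_cell[OF p]
  have u: "p i < p (i + 1)" "p (i - 1) < p i" "p (i + 1) < p (i + 2)" using less by auto
  have jc: "colour_jumps c = range p" using colour_jumps_colouring_of[OF p] cp by simp
  have "\<exists>n l h. (n, l, h) \<in> H \<and> l \<le> p i \<and> p (i + 1) \<le> h"
  proof (cases "even i")
    case False
    then have "c z = Red" if "p i < z" "z \<le> p (i + 1)" for z using cell that cp by simp
    then show ?thesis using red_interval_hull[OF c u(1)] by metis
  next
    case True
    have A: "c z = Red" if "p (i - 1) < z" "z \<le> p i" for z
      using cell[of "i - 1"] that cp True by simp
    have C: "c z = Red" if "p (i + 1) < z" "z \<le> p (i + 2)" for z
      using cell[of "i + 1"] that cp True by (simp add: add.commute)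
    obtain n l h where h: "(n, l, h) \<in> H" "l \<le> p (i - 1)" "p i \<le> h"
      using red_interval_hull[OF c u(2) A] by metis
    obtain n' l' h' where h': "(n', l', h') \<in> H" "l' \<le> p (i + 1)" "p (i + 2) \<le> h'"
      using red_interval_hull[OF c u(3) C] by metis
    show ?thesis
    proof (cases "l = l' \<and> h = h'")
      case True
      then show ?thesis using h h' u by (intro exI[of _ n] exI[of _ l] exI[of _ h]) auto
    next
      case False
      then show ?thesis
        using hull_isolated[OF h(1) h'(1)] hull_isolated[OF h'(1) h(1)] short h h' u False
        by (cases "n \<le> n'") auto
    qed
  qed
  then obtain n l h where h: "(n, l, h) \<in> H" "l \<le> p i" "p (i + 1) \<le> h" by blast
  define q where "q = (\<lambda>j. if j < i then p j else p (j + 2))"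
  note q = boundary_seq_merge[OF p, of i, folded q_def]
    recolour_eq_merge[OF p, of i, folded q_def] range_merge[OF p, of i, folded q_def]
  have j: "colour_jumps (recolour I c) = colour_jumps c - {p i, p (i + 1)}"
    unfolding jc unfolding cp I q(2) using colour_jumps_colouring_of[OF q(1)] q(3) by simp
  have "confined (recolour I c)"
    unfolding confined_def
  proof (intro conjI allI impI)
    show "\<exists>q. boundary_seq q \<and> recolour I c = colouring_of q" using q cp I by metis
    show "colour_jumps (recolour I c) \<subseteq> range P" using j c by (auto simp: confined_def)
    fix x assume "recolour I c x = Red"
    then consider "x \<in> I" | "c x = Red" by (auto simp: recolour_def split: if_splits)
    then show "\<exists>n l h. (n, l, h) \<in> H \<and> l < x \<and> x \<le> h"
    proof cases
      case 1 then show ?thesis using h I by (intro exI[of _ n] exI[of _ l] exI[of _ h]) auto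
    qed (use c in \<open>auto simp: confined_def\<close>)
  qed
  then show ?thesis using that[OF I u(1) h] j jc by auto
qed

lemma confined_initial: "confined (colouring_of P)"
  unfolding confined_def
proof (intro conjI allI impI)
  show "colour_jumps (colouring_of P) \<subseteq> range P" using colour_jumps_colouring_of[OF P] by simp
  fix x assume x: "colouring_of P x = Red"
  obtain k where k: "P k < x" "x \<le> P (k + 1)" using boundary_seq_cell[OF P] .
  then have "odd k" using colouring_of_cell[OF P k] x by (auto split: if_splits)
  then obtain j where "k = 2 * j + 1" by (rule oddE)
  then have "k = 2 * (j + 1) - 1" by simp
  then obtain i where i: "k = 2 * i - 1" by blast
  obtain n l h where "(n, l, h) \<in> H \<and> l \<le> P (2 * i - 1) \<and> P (2 * i) \<le> h"
    using hull_cover by blast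
  then show "\<exists>n l h. (n, l, h) \<in> H \<and> l < x \<and> x \<le> h"
    using k i by (intro exI[of _ n] exI[of _ l] exI[of _ h]) auto
qed (use P in blast)

context
  fixes N J
  assumes J: "complete_recolouring_seq (colouring_of P) N J"
begin

abbreviation "st \<equiv> stage (colouring_of P) J"

lemma recolourable_stage: "enat n < N \<Longrightarrow> recolourable (st n) (J n)"
  using J by (auto simp: complete_recolouring_seq_def recolouring_seq_def)

lemma confined_stage: "enat n \<le> N \<Longrightarrow> confined (st n)"
proof (induction n)
  case (Suc n)
  then have n: "enat n < N" using Suc_ile_eq by blast
  have "confined (st n)" using Suc.IH n by simp
  then show ?case using recolour_confined[OF _ recolourable_stage[OF n]] by (metis stage.simps(2))
qed (use confined_initial in simp)

lemma jumps_decrease: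
  assumes "m \<le> n" "enat n \<le> N" shows "colour_jumps (st n) \<subseteq> colour_jumps (st m)"
  using assms
proof (induction n rule: dec_induct)
  case (step n)
  then have n: "enat n < N" using Suc_ile_eq by blast
  then have "confined (st n)" using confined_stage by simp
  then have "colour_jumps (st (Suc n)) \<subseteq> colour_jumps (st n)"
    using recolour_confined[OF _ recolourable_stage[OF n]] by (metis Diff_subset stage.simps(2))
  moreover have "enat n \<le> N" using n by simp
  ultimately show ?case using step.IH by blast
qed simp

text \<open>Only finitely many boundary-points lie in a bounded window, and none ever reappears.\<close>

lemma jumps_stabilize:
  obtains T where "enat T \<le> N"
    "\<And>n. T \<le> n \<Longrightarrow> enat n \<le> N \<Longrightarrow> colour_jumps (st n) \<inter> {s..t} = colour_jumps (st T) \<inter> {s..t}"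
proof -
  let ?f = "\<lambda>n. card (colour_jumps (st n) \<inter> {s..t})"
  obtain T where T: "enat T \<le> N" "\<And>n. enat n \<le> N \<Longrightarrow> ?f T \<le> ?f n"
    using ex_has_least_nat[of "\<lambda>n. enat n \<le> N" 0 ?f] by (auto simp: zero_enat_def[symmetric])
  show ?thesis
  proof (rule that[OF T(1)])
    fix n assume n: "T \<le> n" "enat n \<le> N"
    have "colour_jumps (st T) \<inter> {s..t} \<subseteq> range P \<inter> {s..t}"
      using confined_stage[OF T(1)] by (auto simp: confined_def)
    then have "finite (colour_jumps (st T) \<inter> {s..t})"
      using boundary_seq_locally_finite[OF P] finite_subset by blast
    then show "colour_jumps (st n) \<inter> {s..t} = colour_jumps (st T) \<inter> {s..t}"
      using T(2)[OF n(2)] jumps_decrease[OF n] by (intro card_seteq) auto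
  qed
qed

text \<open>
  Once the boundary-points in the window are settled, an interval that is recoloured and meets
  the window must contain all of it, hence contain the hull properly. But it lies in a hull, which
  can only be this one.
\<close>

lemma window_stabilizes:
  assumes H: "(n, l, h) \<in> H" and st: "s \<le> l" "h \<le> t"
  shows "\<exists>T. enat T \<le> N \<and> (\<forall>m\<ge>T. enat m < N \<longrightarrow> J m \<inter> {s..t} = {})"
proof -
  obtain T where T: "enat T \<le> N"
    "\<And>n. T \<le> n \<Longrightarrow> enat n \<le> N \<Longrightarrow> colour_jumps (st n) \<inter> {s..t} = colour_jumps (st T) \<inter> {s..t}"
    using jumps_stabilize[of s t] by blast
  have "J m \<inter> {s..t} = {}" if m: "T \<le> m" "enat m < N" for m
  proof (rule ccontr)
    assume "J m \<inter> {s..t} \<noteq> {}"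
    then obtain x where x: "x \<in> J m" "s \<le> x" "x \<le> t" by auto
    have m': "enat (Suc m) \<le> N" using m Suc_ile_eq by blast
    obtain u v n' l' h' where uv: "J m = {u<..v}" "u < v" "(n', l', h') \<in> H" "l' \<le> u" "v \<le> h'"
      "u \<in> colour_jumps (st m)" "v \<in> colour_jumps (st m)"
      "colour_jumps (recolour (J m) (st m)) = colour_jumps (st m) - {u, v}"
      "confined (recolour (J m) (st m))"
      by (rule recolour_confined[OF confined_stage[OF less_imp_le[OF m(2)]]
            recolourable_stage[OF m(2)]])
    have "colour_jumps (st (Suc m)) \<inter> {s..t} = colour_jumps (st m) \<inter> {s..t}"
      using T(2)[of m] T(2)[of "Suc m"] m m' by auto
    then have "(colour_jumps (st m) - {u, v}) \<inter> {s..t} = colour_jumps (st m) \<inter> {s..t}"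
      using uv(8) by simp
    then have "u \<notin> {s..t}" "v \<notin> {s..t}" using uv(6,7) by blast+
    moreover have "u < x" "x \<le> v" using x(1) uv(1) by auto
    ultimately have "u < s" "t < v" using x(2,3) by auto
    moreover have "l = l' \<and> h = h'"
      using hull_unique[OF H uv(3) hull_less[OF H]] calculation st uv(4,5) hull_less[OF H] by auto
    ultimately show False using uv(4) st by auto
  qed
  then show ?thesis using T(1) by blast
qed

lemma stage_const:
  assumes "\<And>m. T \<le> m \<Longrightarrow> enat m < N \<Longrightarrow> x \<notin> J m" "T \<le> n" "enat n \<le> N"
  shows "st n x = st T x"
  using assms(2,3)
proof (induction n rule: dec_induct)
  case (step n)
  then have n: "enat n < N" using Suc_ile_eq by blast
  then show ?case using step assms(1)[of n] by (auto simp: recolour_def)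
qed simp



text \<open>
  Among the finitely many intervals inside the hull take the shortest one. A neighbour inside the hull
  is not shorter. A neighbour outside the hull is blue and extends over the blue
  strip, which has the length of the hull. Equality is excluded by the absence of ties.
\<close>

lemma shortest_interval_recolourable:
  assumes c: "confined c" and H: "(n, l, h) \<in> H" and x: "l < x" "x \<le> h" "c x = Red"
    and left: "\<And>z. l - (h - l) < z \<Longrightarrow> z \<le> l \<Longrightarrow> c z = Blue"
    and right: "\<And>z. h < z \<Longrightarrow> z \<le> h + (h - l) \<Longrightarrow> c z = Blue"
  obtains u v where "recolourable c {u<..v}" "u < v" "l \<le> u" "v \<le> h"
proof -
  obtain p where p: "boundary_seq p" and cp: "c = colouring_of p" using c by (auto simp: confined_def)
  note less = boundary_seq_less[OF p] and cell = colouring_of_cell[OF p, folded cp]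
  have lh: "l < h" using hull_less[OF H] .
  have pP: "p i \<in> range P" for i
    using c colour_jumps_colouring_of[OF p] cp by (auto simp: confined_def)
  have ties: "p (i + 1) - p i \<noteq> p (i + 2) - p (i + 1)" for i
  proof -
    obtain a b d where "p i = P a" "p (i + 1) = P b" "p (i + 2) = P d" using pP by blast
    moreover have "p i < p (i + 1)" "p (i + 1) < p (i + 2)" using less by auto
    ultimately show ?thesis using no_ties[of a b d] boundary_seq_less[OF P] by simp
  qed
  define In where "In = {i. l \<le> p i \<and> p (i + 1) \<le> h}"
  have red_in: "i \<in> In" if "odd i" "l < z" "z \<le> h" "p i < z" "z \<le> p (i + 1)" for i z
    using red_interval_in_hull[OF c _ H that(2,3), of "p i" "p (i + 1)"] cell[of i] that
    by (auto simp: In_def)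
  have "In \<noteq> {}"
  proof -
    obtain i where i: "p i < x" "x \<le> p (i + 1)" using boundary_seq_cell[OF p] .
    then have "odd i" using cell[OF i] x by (auto split: if_splits)
    then show ?thesis using red_in i x by auto
  qed
  moreover have "finite In"
  proof -
    have "p ` In \<subseteq> range p \<inter> {l..h}" 
    proof
      fix y assume "y \<in> p ` In"
      then obtain j where j: "y = p j" "l \<le> p j" "p (j + 1) \<le> h" by (auto simp: In_def)
      have "p j < p (j + 1)" using less by simp
      then show "y \<in> range p \<inter> {l..h}" using j by simp
    qed
    then have "finite (p ` In)" using boundary_seq_locally_finite[OF p] finite_subset by blast
    moreover have "inj p" using p by (auto simp: boundary_seq_def intro: strict_mono_imp_inj_on)
    ultimately show ?thesis using finite_imageD inj_on_subset by blast
  qed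
  ultimately obtain i where i: "i \<in> In" and
    min: "\<And>j. j \<in> In \<Longrightarrow> p (i + 1) - p i \<le> p (j + 1) - p j"
    using ex_is_arg_min_if_finite[of In "\<lambda>j. p (j + 1) - p j"] by (auto simp: is_arg_min_linorder)
  have pi: "p i < p (i + 1)" "p (i - 1) < p i" "p (i + 1) < p (i + 2)" using less by auto
  have li: "l \<le> p i" "p (i + 1) \<le> h" using i by (auto simp: In_def)
  have "p (i + 1) - p i \<le> p (i + 2) - p (i + 1)"
  proof (cases "i + 1 \<in> In")
    case True
    then show ?thesis using min[of "i + 1"] by (simp add: add.commute)
  next
    case False
    then have out: "h < p (i + 2)" using li pi by (auto simp: In_def add.commute)
    have "even (i + 1)"
    proof (rule ccontr)
      assume odd: "odd (i + 1)"
      show False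
      proof (cases "p (i + 1) < h")
        case True
        then show False using red_in[OF odd, of h] False lh out by (auto simp: add.commute)
      next
        case h: False
        define z where "z = min (p (i + 2)) (h + (h - l))"
        have "c z = Red" using cell[of "i + 1" z] odd h li lh pi out
          by (auto simp: z_def add.commute)
        then show False using right[of z] lh out by (auto simp: z_def)
      qed
    qed
    then have red: "c z = Red" if "p (i + 2) < z" "z \<le> p (i + 3)" for z
      using cell[of "i + 2" z] that by (auto simp: add.commute)
    have "h + (h - l) \<le> p (i + 2)"
    proof (rule ccontr)
      assume *: "\<not> h + (h - l) \<le> p (i + 2)"
      have "p (i + 2) < p (i + 3)" using less by auto
      define z where "z = min (p (i + 3)) (h + (h - l))"
      have "c z = Red" using red[of z] * \<open>p (i + 2) < p (i + 3)\<close> by (auto simp: z_def)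
      then show False using right[of z] * out \<open>p (i + 2) < p (i + 3)\<close> by (auto simp: z_def)
    qed
    then show ?thesis using li by linarith
  qed
  moreover have "p (i + 1) - p i \<le> p i - p (i - 1)"
  proof (cases "i - 1 \<in> In")
    case True
    then show ?thesis using min[of "i - 1"] by simp
  next
    case False
    then have out: "p (i - 1) < l" using li pi by (auto simp: In_def)
    have "even (i - 1)"
    proof (rule ccontr)
      assume odd: "odd (i - 1)"
      show False
      proof (cases "l < p i")
        case True
        then show False using red_in[OF odd, of "p i"] False li pi by auto
      next
        case l: False
        then have "c l = Red" using cell[of "i - 1" l] odd li pi out by auto
        then show False using left[of l] lh by auto
      qed
    qed
    then have red: "c z = Red" if "p (i - 2) < z" "z \<le> p (i - 1)" for z
      using cell[of "i - 2" z] that by auto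
    have "p (i - 1) \<le> l - (h - l)"
    proof (rule ccontr)
      assume *: "\<not> p (i - 1) \<le> l - (h - l)"
      have "p (i - 2) < p (i - 1)" using less by auto
      then have "c (p (i - 1)) = Red" using red by auto
      then show False using left[of "p (i - 1)"] * out by auto
    qed
    then show ?thesis using li by linarith
  qed
  moreover have "p i - p (i - 1) \<noteq> p (i + 1) - p i" using ties[of "i - 1"] by (simp add: add.commute)
  ultimately have "p (i + 1) - p i < p i - p (i - 1)" "p (i + 1) - p i < p (i + 2) - p (i + 1)"
    using ties[of i] by linarith+
  then have "recolourable c {p i<..p (i + 1)}"
    unfolding recolourable_def using p cp by blast
  then show ?thesis using that pi li by blast
qed

lemma unchanged_eventually:
  "\<exists>T. enat T \<le> N \<and> (\<forall>m\<ge>T. enat m < N \<longrightarrow> x \<notin> J m)"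
proof (cases "\<exists>n l h. (n, l, h) \<in> H \<and> l < x \<and> x \<le> h")
  case True
  then obtain n l h where H: "(n, l, h) \<in> H" "l < x" "x \<le> h" by blast
  obtain T where T: "enat T \<le> N" "\<And>m. T \<le> m \<Longrightarrow> enat m < N \<Longrightarrow> J m \<inter> {l..h} = {}"
    using window_stabilizes[OF H(1) order.refl order.refl] by blast
  have "x \<notin> J m" if "T \<le> m" "enat m < N" for m
    using T(2)[OF that] H(2,3) by auto
  then show ?thesis using T(1) by blast
next
  case False
  have "x \<notin> J m" if m: "enat m < N" for m
  proof
    assume x: "x \<in> J m"
    obtain u v n l h where uv: "J m = {u<..v}" "u < v" "(n, l, h) \<in> H" "l \<le> u" "v \<le> h"
      "u \<in> colour_jumps (st m)" "v \<in> colour_jumps (st m)"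
      "colour_jumps (recolour (J m) (st m)) = colour_jumps (st m) - {u, v}"
      "confined (recolour (J m) (st m))"
      by (rule recolour_confined[OF confined_stage[OF less_imp_le[OF m]] recolourable_stage[OF m]])
    then have "l < x" "x \<le> h" using x by auto
    then show False using uv(3) False by blast
  qed
  moreover have "enat 0 \<le> N" by (simp add: zero_enat_def[symmetric])
  ultimately show ?thesis by blast
qed

definition finally_red :: "real \<Rightarrow> bool" where
  "finally_red x \<longleftrightarrow> (\<exists>T. enat T \<le> N \<and> (\<forall>m\<ge>T. enat m \<le> N \<longrightarrow> st m x = Red))"

text \<open>
  In a hull of minimal rank that contains finally red points, all red is eventually settled, and so
  is the blue around it: any other hull with finally red points has at least the same rank, so
  it keeps a distance of at least the length of this one. Then there is a recolourable interval that
  is never recoloured.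
\<close>

lemma not_finally_red: "\<not> finally_red x"
proof
  assume "finally_red x"
  let ?Q = "\<lambda>n. \<exists>l h y. (n, l, h) \<in> H \<and> l < y \<and> y \<le> h \<and> finally_red y"
  have in_hull: "\<exists>n l h. (n, l, h) \<in> H \<and> l < y \<and> y \<le> h" if "finally_red y" for y
  proof -
    obtain T where "enat T \<le> N" "st T y = Red" using \<open>finally_red y\<close> by (auto simp: finally_red_def)
    then show ?thesis using confined_stage[of T] by (auto simp: confined_def)
  qed
  then obtain n0 where "?Q n0" using \<open>finally_red x\<close> by blast
  then obtain n where n: "?Q n" and min: "\<And>m. ?Q m \<Longrightarrow> n \<le> m"
    using exists_least_iff[of ?Q] not_less by meson
  then obtain l h y where H: "(n, l, h) \<in> H" and y: "l < y" "y \<le> h" "finally_red y" by blast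
  \<comment> \<open>The window extends the hull by its own length on both sides.\<close>
  define w where "w = h - l"
  have "l < h" using hull_less[OF H] .
  then have w: "l - w \<le> l" "h \<le> h + w" by (auto simp: w_def)
  obtain T where T: "enat T \<le> N"
    "\<And>m. T \<le> m \<Longrightarrow> enat m < N \<Longrightarrow> J m \<inter> {l - w..h + w} = {}"
    using window_stabilizes[OF H w] by blast
  have const: "st m z = st T z" if "l - w \<le> z" "z \<le> h + w" "T \<le> m" "enat m \<le> N" for m z
  proof (rule stage_const[OF _ that(3,4)])
    fix k assume "T \<le> k" "enat k < N"
    from T(2)[OF this] show "z \<notin> J k" using that(1,2) by auto
  qed
  have fin: "st T z = Red \<longleftrightarrow> finally_red z" if z: "l - w \<le> z" "z \<le> h + w" for z
  proof
    assume "st T z = Red"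
    then have "\<forall>m\<ge>T. enat m \<le> N \<longrightarrow> st m z = Red" using const[OF z] by simp
    then show "finally_red z" using T(1) unfolding finally_red_def by blast
  next
    assume "finally_red z"
    then obtain S where S: "enat S \<le> N" "\<And>m. m \<ge> S \<Longrightarrow> enat m \<le> N \<Longrightarrow> st m z = Red"
      by (auto simp: finally_red_def)
    then have "st (max S T) z = Red" "enat (max S T) \<le> N" using T(1) by (auto simp: max_def)
    then show "st T z = Red" using const[OF z, of "max S T"] by auto
  qed
  have blue: "st T z = Blue" if z: "l - w < z" "z \<le> l \<or> h < z" "z \<le> h + w" for z
  proof (rule ccontr)
    assume "st T z \<noteq> Blue"
    then have "finally_red z" using fin z by (cases "st T z") auto
    then obtain m l' h' where H': "(m, l', h') \<in> H" "l' < z" "z \<le> h'" using in_hull by blast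
    then have "n \<le> m" using min \<open>finally_red z\<close> by blast
    then show False using hull_isolated[OF H H'(1)] H' z w_def by auto
  qed
  have "st T y = Red" using fin[of y] y \<open>l < h\<close> w_def by auto
  then obtain u v where uv: "recolourable (st T) {u<..v}" "u < v" "l \<le> u" "v \<le> h"
  proof (rule shortest_interval_recolourable[OF confined_stage[OF T(1)] H y(1,2)])
    show "st T z = Blue" if "l - (h - l) < z" "z \<le> l" for z
      using blue[of z] that \<open>l < h\<close> by (auto simp: w_def)
    show "st T z = Blue" if "h < z" "z \<le> h + (h - l)" for z
      using blue[of z] that \<open>l < h\<close> by (auto simp: w_def)
  qed
  then obtain m where m: "m \<ge> T" "enat m < N" "J m = {u<..v}"
    using J T(1) unfolding complete_recolouring_seq_def by blast
  then have "v \<in> J m \<inter> {l - w..h + w}" using uv \<open>l < h\<close> by (auto simp: w_def)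
  then show False using T(2)[OF m(1,2)] by blast
qed

lemma finally_blue_all: "finally_blue (colouring_of P) N J x"
proof -
  obtain T where T: "enat T \<le> N" "\<forall>m\<ge>T. enat m < N \<longrightarrow> x \<notin> J m"
    using unchanged_eventually[of x] by blast
  have const: "\<forall>m\<ge>T. enat m \<le> N \<longrightarrow> st m x = st T x"
    using stage_const[of T x] T(2) by blast
  have sub: "{n. enat n < N \<and> st (Suc n) x \<noteq> st n x} \<subseteq> {..<T}"
  proof
    fix n assume n: "n \<in> {n. enat n < N \<and> st (Suc n) x \<noteq> st n x}"
    then have "x \<in> J n" by (simp add: recolour_def split: if_splits)
    then have "\<not> T \<le> n" using T(2) n by blast
    then show "n \<in> {..<T}" by simp
  qed
  have "st T x \<noteq> Red"
  proof
    assume "st T x = Red"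
    then have "finally_red x" unfolding finally_red_def using const T(1) by metis
    then show False using not_finally_red by blast
  qed
  then have "st T x = Blue" by (cases "st T x") simp_all
  then have "\<forall>m\<ge>T. enat m \<le> N \<longrightarrow> st m x = Blue" using const by simp
  then have "\<exists>n. enat n \<le> N \<and> (\<forall>m\<ge>n. enat m \<le> N \<longrightarrow> st m x = Blue)" using T(1) by blast
  then show ?thesis
    unfolding finally_blue_def using finite_subset[OF sub finite_lessThan] by blast
qed

end
end

section \<open>Islands of red intervals\<close>

definition level_scale :: "nat \<Rightarrow> real" where "level_scale n = 32 ^ n / 8"

lemma level_scale_pos: "0 < level_scale n" by (simp add: level_scale_def)

lemma level_scale_Suc: "level_scale (Suc n) = 32 * level_scale n" by (simp add: level_scale_def)

text \<open>
  A witness is a finite set of requirements \<open>(z, j)\<close>, to be read as: red interval \<open>z\<close> is longer than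
  \<open>level_scale j / 16\<close>. It explains why a red interval near \<open>y\<close> survives the rounds \<open>0, \<dots>, n\<close>: either
  interval \<open>y\<close> is very long, or two witnesses for the earlier rounds hold at nearby sites. Since
  these concern different red intervals, their requirements are independent.
\<close>

primrec witnesses :: "nat \<Rightarrow> int \<Rightarrow> (int \<times> nat) set set" where
  "witnesses 0 y = {{(y, 0)}}"
| "witnesses (Suc n) y = insert {(y, Suc n)} {F \<union> G |F G y'. F \<in> witnesses n y \<and> G \<in> witnesses n y' \<and>
     \<bar>real_of_int (y - y')\<bar> \<le> 5 * level_scale (Suc n) \<and> fst ` F \<inter> fst ` G = {}}"

text \<open>
  Red interval \<open>x\<close> extends from \<open>L x\<close> to \<open>R x\<close>. As the blue intervals in between have length at
  least \<open>1\<close>, distances on the line dominate differences of indices.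
\<close>

locale spaced_intervals =
  fixes L R :: "int \<Rightarrow> real"
  assumes nonempty: "L x < R x" and spacing: "R x + 1 \<le> L (x + 1)"
begin

definition len :: "int \<Rightarrow> real" where "len x = R x - L x"
definition gap_between :: "int \<Rightarrow> int \<Rightarrow> real" where
  "gap_between x y = max 0 (max (L x - R y) (L y - R x))"
definition hull_length :: "int \<Rightarrow> int \<Rightarrow> real" where
  "hull_length x y = max (R x) (R y) - min (L x) (L y)"

lemma spacing_trans:
  assumes "x < y" shows "R x + real_of_int (y - x) \<le> L y"
proof -
  have "R x + real_of_int (y - x) \<le> L y" if "x + 1 \<le> y" for y
    using that
  proof (induction y rule: int_ge_induct)
    case base
    then show ?case using spacing[of x] by simp
  next
    case (step i)
    then show ?case using spacing[of i] nonempty[of i] by simp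
  qed
  then show ?thesis using assms by simp
qed

lemma index_distance_le_gap: "\<bar>real_of_int (x - y)\<bar> \<le> gap_between x y"
  using spacing_trans[of x y] spacing_trans[of y x]
  by (cases x y rule: linorder_cases) (auto simp: gap_between_def)

lemma gap_commute: "gap_between x y = gap_between y x"
  by (auto simp: gap_between_def)

lemma gap_same: "gap_between x x = 0"
  using nonempty[of x] by (auto simp: gap_between_def)

lemma gap_triangle: "gap_between x z \<le> gap_between x y + len y + gap_between y z"
  using nonempty[of y] by (auto simp: gap_between_def len_def)

lemma hull_length_le: "hull_length x y \<le> len x + gap_between x y + len y"
  using nonempty[of x] nonempty[of y] by (auto simp: gap_between_def hull_length_def len_def)

lemma hull_length_same: "hull_length x x = len x"
  by (auto simp: hull_length_def len_def)

text \<open>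
  Two measures of separation are needed because red intervals can be long themselves. The gap
  does not include the lengths of \<open>w\<close> and \<open>y\<close>, the hull does. In particular, a very long red interval
  next to \<open>w\<close> keeps \<open>w\<close> from being isolated, and \<open>hull_length w w\<close> is the length of \<open>w\<close>, so that
  no long red interval is the centre of an island in an early round.
\<close>

primrec survivors :: "nat \<Rightarrow> int set" where
  "survivors 0 = UNIV"
| "survivors (Suc n) = {x \<in> survivors n. \<forall>w\<in>survivors n. gap_between w x \<le> 4 * level_scale n \<longrightarrow>
     (\<exists>y\<in>survivors n. gap_between w y \<le> 4 * level_scale n \<and> level_scale n < hull_length w y)}"

definition centre :: "nat \<Rightarrow> int \<Rightarrow> bool" where
  "centre n w \<longleftrightarrow> w \<in> survivors n \<and>
     (\<forall>y\<in>survivors n. gap_between w y \<le> 4 * level_scale n \<longrightarrow> hull_length w y \<le> level_scale n)"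

definition island :: "nat \<Rightarrow> int \<Rightarrow> int set" where
  "island n w = {y \<in> survivors n. gap_between w y \<le> 4 * level_scale n}"

lemma survivors_Suc: "survivors (Suc n) = {x \<in> survivors n. \<forall>w. centre n w \<longrightarrow> x \<notin> island n w}"
proof -
  have "centre n w \<longleftrightarrow> w \<in> survivors n \<and>
      \<not> (\<exists>y\<in>survivors n. gap_between w y \<le> 4 * level_scale n \<and> level_scale n < hull_length w y)" for w
    unfolding centre_def not_less[symmetric] by blast
  then show ?thesis by (simp add: island_def) blast
qed

lemma survivors_antimono: "m \<le> n \<Longrightarrow> survivors n \<subseteq> survivors m"
  by (induction n rule: dec_induct) auto

lemma finite_island: "finite (island n w)"
proof -
  have "island n w \<subseteq> {w - \<lceil>4 * level_scale n\<rceil>..w + \<lceil>4 * level_scale n\<rceil>}"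
  proof
    fix y assume "y \<in> island n w"
    then have "\<bar>real_of_int (w - y)\<bar> \<le> 4 * level_scale n"
      using index_distance_le_gap[of w y] by (auto simp: island_def)
    then show "y \<in> {w - \<lceil>4 * level_scale n\<rceil>..w + \<lceil>4 * level_scale n\<rceil>}" by (simp; linarith)
  qed
  then show ?thesis using finite_subset by blast
qed

lemma centre_in_island: "centre n w \<Longrightarrow> w \<in> island n w"
  using level_scale_pos[of n] by (auto simp: centre_def island_def gap_same)

definition island_left :: "nat \<Rightarrow> int \<Rightarrow> real" where "island_left n w = Min (L ` island n w)"
definition island_right :: "nat \<Rightarrow> int \<Rightarrow> real" where "island_right n w = Max (R ` island n w)"

lemma island_bounds:
  assumes "y \<in> island n w" shows "island_left n w \<le> L y" "R y \<le> island_right n w"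
  using assms finite_island by (auto simp: island_left_def island_right_def)

lemma island_left_attained:
  assumes "centre n w" obtains y where "y \<in> island n w" "island_left n w = L y"
proof -
  have "Min (L ` island n w) \<in> L ` island n w"
    using finite_island[of n w] centre_in_island[OF assms] by (intro Min_in) auto
  then show ?thesis using that by (auto simp: island_left_def)
qed

lemma island_right_attained:
  assumes "centre n w" obtains y where "y \<in> island n w" "island_right n w = R y"
proof -
  have "Max (R ` island n w) \<in> R ` island n w"
    using finite_island[of n w] centre_in_island[OF assms] by (intro Max_in) auto
  then show ?thesis using that by (auto simp: island_right_def)
qed

lemma island_near_centre:
  assumes "centre n w" "y \<in> island n w"
  shows "R w - level_scale n \<le> L y" "R y \<le> L w + level_scale n"
  using assms by (auto simp: centre_def island_def hull_length_def)

lemma island_hull_near_centre: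
  assumes "centre n w"
  shows "R w - level_scale n \<le> island_left n w" "island_right n w \<le> L w + level_scale n"
    "island_left n w < island_right n w"
proof -
  show "R w - level_scale n \<le> island_left n w" "island_right n w \<le> L w + level_scale n"
    using island_left_attained[OF assms] island_right_attained[OF assms]
      island_near_centre[OF assms] by metis+
  show "island_left n w < island_right n w"
    using island_bounds[OF centre_in_island[OF assms]] nonempty[of w] by linarith
qed

text \<open>
  Any two members of an island are at distance less than \<open>2 * level_scale n\<close>, while the others are
  further than \<open>4 * level_scale n\<close> from a centre; hence the island does not depend on the choice of a
  centre in it.
\<close>

lemma island_eq:
  assumes w: "centre n w" and w': "centre n w'" and "w' \<in> island n w"
  shows "island n w = island n w'"
proof -
  have sub: "island n v \<subseteq> island n v'" if v: "centre n v" "v' \<in> island n v" for v v'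
  proof
    fix z assume z: "z \<in> island n v"
    have "gap_between v' z \<le> 4 * level_scale n"
      using island_near_centre[OF v] island_near_centre[OF v(1) z] nonempty[of v] nonempty[of z]
        nonempty[of v'] level_scale_pos[of n] by (auto simp: gap_between_def)
    then show "z \<in> island n v'" using z by (simp add: island_def)
  qed
  have "w \<in> island n w'"
    using assms by (auto simp: island_def centre_def gap_commute)
  then show ?thesis using sub[OF w assms(3)] sub[OF w'] by blast
qed

lemma far_from_island:
  assumes w: "centre n w" and z: "z \<in> survivors n" "z \<notin> island n w"
  shows "R w + 4 * level_scale n < L z \<or> R z < L w - 4 * level_scale n"
  using z level_scale_pos[of n] by (auto simp: island_def gap_between_def)

text \<open>
  The hull of the lower island has length less than \<open>2 * level_scale n\<close>. Members of the other island
  are at distance more than \<open>4 * level_scale n\<close> from the centre \<open>w\<close>. If they are all on one side of \<open>w\<close>, the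
  hulls are far apart, otherwise the other hull encloses the lower one.
\<close>

lemma islands_laminar:
  assumes w: "centre n w" and w': "centre m w'" and "n \<le> m"
  defines "l \<equiv> island_left n w" and "h \<equiv> island_right n w"
    and "l' \<equiv> island_left m w'" and "h' \<equiv> island_right m w'"
  shows "l = l' \<and> h = h' \<or> h - l \<le> l' - h \<or> h - l \<le> l - h' \<or> l' \<le> l \<and> h \<le> h'"
proof -
  note b = island_hull_near_centre[OF w, folded l_def h_def]
  note b' = island_hull_near_centre[OF w', folded l'_def h'_def]
  have pos: "0 < level_scale n" by (rule level_scale_pos)
  have lw: "L w < R w" "L w' < R w'" by (rule nonempty)+
  have wm: "w' \<in> survivors m" using w' by (simp add: centre_def)
  show ?thesis
  proof (cases "n = m")
    case True
    show ?thesis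
    proof (cases "w' \<in> island n w")
      case True
      have "island n w = island n w'"
        using island_eq[OF w _ True] w' \<open>n = m\<close> by simp
      then show ?thesis using \<open>n = m\<close>
        by (simp add: l_def h_def l'_def h'_def island_left_def island_right_def)
    next
      case False
      then show ?thesis using far_from_island[OF w _ False] wm b b' pos lw \<open>n = m\<close> by auto
    qed
  next
    case False
    then have "survivors m \<subseteq> survivors (Suc n)" using survivors_antimono[of "Suc n" m] \<open>n \<le> m\<close> by simp
    then have "z \<in> survivors n \<and> z \<notin> island n w" if "z \<in> island m w'" for z
      using that w survivors_Suc[of n] by (auto simp: island_def[of m w'])
    then have far: "R w + 4 * level_scale n < L z \<or> R z < L w - 4 * level_scale n" if "z \<in> island m w'" for z
      using far_from_island[OF w] that by blast
    obtain y where y: "y \<in> island m w'" "l' = L y" 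
      using island_left_attained[OF w'] by (auto simp: l'_def)
    obtain z where z: "z \<in> island m w'" "h' = R z"
      using island_right_attained[OF w'] by (auto simp: h'_def)
    show ?thesis using far[OF y(1)] far[OF z(1)] y(2) z(2) b b' pos lw nonempty[of y] nonempty[of z]
      by auto
  qed
qed

lemma near_of_hull_contains:
  assumes "centre n w" "island_left n w \<le> L x" "R x \<le> island_right n w"
  shows "gap_between x w \<le> level_scale n"
  using island_hull_near_centre[OF assms(1)] assms(2,3) nonempty[of x] nonempty[of w]
    level_scale_pos[of n] by (auto simp: gap_between_def)

text \<open>Passing to maximal hulls eliminates nesting, and leaves equal or distant hulls.\<close>

definition maximal_hulls :: "(nat \<times> real \<times> real) set" where
  "maximal_hulls = {(n, l, h). \<exists>w. centre n w \<and> l = island_left n w \<and> h = island_right n w \<and>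
     (\<forall>m w'. centre m w' \<longrightarrow> island_left m w' \<le> l \<longrightarrow> h \<le> island_right m w' \<longrightarrow>
        island_left m w' = l \<and> island_right m w' = h)}"

lemma maximal_hulls_less: "(n, l, h) \<in> maximal_hulls \<Longrightarrow> l < h"
  using island_hull_near_centre by (auto simp: maximal_hulls_def)

lemma maximal_hulls_isolated:
  assumes "(n, l, h) \<in> maximal_hulls" "(m, l', h') \<in> maximal_hulls" "n \<le> m"
  shows "l = l' \<and> h = h' \<or> h - l \<le> l' - h \<or> h - l \<le> l - h'"
proof -
  obtain w where w: "centre n w" "l = island_left n w" "h = island_right n w"
    and max: "\<And>m w'. centre m w' \<Longrightarrow> island_left m w' \<le> l \<Longrightarrow> h \<le> island_right m w' \<Longrightarrow>
        island_left m w' = l \<and> island_right m w' = h"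
    using assms(1) unfolding maximal_hulls_def by blast
  obtain w' where w': "centre m w'" "l' = island_left m w'" "h' = island_right m w'"
    using assms(2) unfolding maximal_hulls_def by blast
  show ?thesis
    using islands_laminar[OF w(1) w'(1) assms(3)] max[OF w'(1)] w w' by metis
qed

text \<open>
  The assumption bounds the rounds of the islands whose hull contains interval \<open>x\<close>, and it forces \<open>x\<close>
  itself to be removed at some round. An island of the last of these rounds has a maximal hull.
\<close>

lemma maximal_hulls_cover:
  assumes far: "\<And>n w. n0 \<le> n \<Longrightarrow> w \<in> survivors n \<Longrightarrow> level_scale n < gap_between x w"
  shows "\<exists>n l h. (n, l, h) \<in> maximal_hulls \<and> l \<le> L x \<and> R x \<le> h"
proof -
  define A where "A = {n. \<exists>w. centre n w \<and> island_left n w \<le> L x \<and> R x \<le> island_right n w}"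
  have "A \<subseteq> {..<n0}"
  proof
    fix n assume "n \<in> A"
    then obtain w where "centre n w" "gap_between x w \<le> level_scale n"
      using near_of_hull_contains by (auto simp: A_def)
    then show "n \<in> {..<n0}" using far[of n w] by (auto simp: centre_def not_le[symmetric])
  qed
  then have fin: "finite A" using finite_subset by blast
  have "x \<notin> survivors n0" using far[of n0 x] level_scale_pos[of n0] by (auto simp: gap_same)
  moreover have "x \<in> survivors 0" by simp
  ultimately have "\<exists>n. x \<in> survivors n \<and> x \<notin> survivors (Suc n)"
    using nat_induct[of "\<lambda>n. x \<in> survivors n" n0] by blast
  then obtain n where "x \<in> survivors n" "x \<notin> survivors (Suc n)" by blast
  then obtain w where "centre n w" "x \<in> island n w" using survivors_Suc by blast
  then have "n \<in> A" using island_bounds by (auto simp: A_def)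
  then have M: "Max A \<in> A" using fin Max_in by blast
  then obtain v where v: "centre (Max A) v" "island_left (Max A) v \<le> L x"
    "R x \<le> island_right (Max A) v" by (auto simp: A_def)
  have "island_left m w' = island_left (Max A) v \<and> island_right m w' = island_right (Max A) v"
    if m: "centre m w'" "island_left m w' \<le> island_left (Max A) v"
      "island_right (Max A) v \<le> island_right m w'" for m w'
  proof -
    have "m \<in> A" using m v by (auto simp: A_def)
    then have "m \<le> Max A" using fin by simp
    then show ?thesis
      using islands_laminar[OF m(1) v(1)] m v nonempty[of x] island_hull_near_centre(3)[OF v(1)]
      by auto
  qed
  then show ?thesis using v unfolding maximal_hulls_def by blast
qed


section \<open>Witnesses of survival\<close>

lemma survivor_not_centre:
  assumes "x \<in> survivors (Suc n)"
  obtains y where "x \<in> survivors n" "y \<in> survivors n" "gap_between x y \<le> 4 * level_scale n"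
    "level_scale n < hull_length x y"
  using assms level_scale_pos[of n] gap_same[of x] by auto

text \<open>
  In the induction step let \<open>a\<close> be the new scale. If a red interval longer than \<open>a / 16\<close> is near \<open>x\<close>, it
  alone is the witness. It is important that the witness is attached to the site \<open>y\<close> of this
  interval and not to \<open>x\<close>: otherwise the same cause would be counted for each \<open>x\<close> near it.
  If all red intervals near \<open>x\<close> are short, take the other survivor \<open>x'\<close>. A red interval \<open>z\<close>
  common to the witnesses of \<open>x\<close> and \<open>x'\<close> would be at distance at most \<open>13 a / 32\<close> from both, and the hull
  of \<open>x\<close> and \<open>x'\<close> would have length at most \<open>2 (13 a / 32) + 3 (a / 16) = a\<close>. This computation is
  what requires consecutive scales to differ by a factor as large as \<open>32\<close>.
\<close>

lemma survivors_witness: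
  assumes "x \<in> survivors (Suc n)"
  shows "\<exists>y F. F \<in> witnesses n y \<and> gap_between x y \<le> 5 * level_scale n \<and>
    (\<forall>(z, j)\<in>F. level_scale j / 16 < len z \<and> gap_between y z \<le> 6 * level_scale n)"
  using assms
proof (induction n arbitrary: x)
  case 0
  obtain y where y: "gap_between x y \<le> 4 * level_scale 0" "level_scale 0 < hull_length x y"
    using survivor_not_centre[OF 0] by metis
  then have "\<bar>real_of_int (x - y)\<bar> < 1"
    using index_distance_le_gap[of x y] by (simp add: level_scale_def)
  then have "x = y" by linarith
  then show ?case using y
    by (intro exI[of _ x] exI[of _ "{(x, 0)}"])
      (auto simp: hull_length_same gap_same level_scale_def)
next
  case (Suc n)
  define a where "a = level_scale (Suc n)"
  have a: "0 < a" "level_scale n = a / 32" unfolding a_def using level_scale_pos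
    by (simp_all add: level_scale_Suc)
  show ?case
  proof (cases "\<exists>y. gap_between x y \<le> 5 * a \<and> a / 16 < len y")
    case True
    then obtain y where "gap_between x y \<le> 5 * a" "a / 16 < len y" by blast
    then show ?thesis using a
      by (intro exI[of _ y] exI[of _ "{(y, Suc n)}"]) (auto simp: gap_same a_def[symmetric])
  next
    case False
    then have short: "len y \<le> a / 16" if "gap_between x y \<le> 5 * a" for y
      using that by (meson not_le)
    obtain x' where xs: "x \<in> survivors (Suc n)" "x' \<in> survivors (Suc n)"
      and x': "gap_between x x' \<le> 4 * a" "a < hull_length x x'"
      using survivor_not_centre[OF Suc.prems] unfolding a_def by metis
    obtain y F where F: "F \<in> witnesses n y" "gap_between x y \<le> 5 * a / 32"
      "\<And>z j. (z, j) \<in> F \<Longrightarrow> level_scale j / 16 < len z"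
      "\<And>z j. (z, j) \<in> F \<Longrightarrow> gap_between y z \<le> 6 * a / 32"
      using Suc.IH[OF xs(1)] unfolding a by fastforce
    obtain y' G where G: "G \<in> witnesses n y'" "gap_between x' y' \<le> 5 * a / 32"
      "\<And>z j. (z, j) \<in> G \<Longrightarrow> level_scale j / 16 < len z"
      "\<And>z j. (z, j) \<in> G \<Longrightarrow> gap_between y' z \<le> 6 * a / 32"
      using Suc.IH[OF xs(2)] unfolding a by fastforce
    \<comment> \<open>All intervals considered here are within distance \<open>5 a\<close> of \<open>x\<close>, hence short.\<close>
    have len: "len x \<le> a / 16" "len x' \<le> a / 16" "len y \<le> a / 16"
      using short[of x] short[of x'] short[of y] x' F(2) a(1) by (auto simp: gap_same)
    have len': "len y' \<le> a / 16"
      using short[of y'] gap_triangle[of x y' x'] x'(1) G(2) len(2) a(1) by linarith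
    have yy': "gap_between y y' \<le> 4 * a + 2 * (5 * a / 32) + 2 * (a / 16)"
      using gap_triangle[of y y' x] gap_triangle[of x y' x'] x'(1) F(2) G(2) len
        gap_commute[of x y] by linarith
    have "fst ` F \<inter> fst ` G = {}"
    proof (rule ccontr)
      assume "fst ` F \<inter> fst ` G \<noteq> {}"
      then obtain z j k where z: "(z, j) \<in> F" "(z, k) \<in> G" by fastforce
      have "gap_between x z \<le> 5 * a / 32 + a / 16 + 6 * a / 32"
        using gap_triangle[of x z y] F(2) F(4)[OF z(1)] len(3) by linarith
      moreover have "gap_between x' z \<le> 5 * a / 32 + a / 16 + 6 * a / 32"
        using gap_triangle[of x' z y'] G(2) G(4)[OF z(2)] len' by linarith
      moreover have "len z \<le> a / 16" using short[of z] calculation(1) a(1) by linarith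
      ultimately show False
        using hull_length_le[of x x'] gap_triangle[of x x' z] gap_commute[of x' z] len x'(2)
        by linarith
    qed
    moreover have "\<bar>real_of_int (y - y')\<bar> \<le> 5 * a"
      using index_distance_le_gap[of y y'] yy' a(1) by linarith
    ultimately have "F \<union> G \<in> witnesses (Suc n) y"
      using F(1) G(1) unfolding a_def witnesses.simps by blast
    moreover have "gap_between y z \<le> 6 * a" if "(z, j) \<in> F \<union> G" for z j
      using that F(4)[of z j] G(4)[of z j] gap_triangle[of y z y'] yy' len' a(1)
      by (auto; linarith)
    ultimately show ?thesis
      using F(2,3) G(3) a(1) unfolding a_def[symmetric]
      by (intro exI[of _ y] exI[of _ "F \<union> G"]) auto
  qed
qed

end

section \<open>The probability of witnesses\<close>

definition weight :: "(nat \<Rightarrow> real) \<Rightarrow> (int \<times> nat) set \<Rightarrow> real" where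
  "weight t F = (\<Prod>(z, j)\<in>F. t j)"

lemma finite_int_ball: "finite {y::int. \<bar>real_of_int (x - y)\<bar> \<le> c}"
proof (rule finite_subset)
  show "{y. \<bar>real_of_int (x - y)\<bar> \<le> c} \<subseteq> {x - \<lceil>c\<rceil>..x + \<lceil>c\<rceil>}"
    by (auto; linarith)
qed simp

lemma card_int_ball:
  assumes "0 \<le> c" shows "real (card {y::int. \<bar>real_of_int (x - y)\<bar> \<le> c}) \<le> 2 * c + 1"
proof -
  have "{y. \<bar>real_of_int (x - y)\<bar> \<le> c} \<subseteq> {x - \<lfloor>c\<rfloor>..x + \<lfloor>c\<rfloor>}"
    by (auto; linarith)
  then have "card {y::int. \<bar>real_of_int (x - y)\<bar> \<le> c} \<le> card {x - \<lfloor>c\<rfloor>..x + \<lfloor>c\<rfloor>}"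
    by (intro card_mono) auto
  also have "\<dots> = nat (2 * \<lfloor>c\<rfloor> + 1)" by simp
  finally have "real (card {y::int. \<bar>real_of_int (x - y)\<bar> \<le> c}) \<le> real (nat (2 * \<lfloor>c\<rfloor> + 1))"
    by simp
  also have "\<dots> = 2 * real_of_int \<lfloor>c\<rfloor> + 1" using assms by simp
  also have "\<dots> \<le> 2 * c + 1" by simp
  finally show ?thesis .
qed

lemma witness_finite_inj: "F \<in> witnesses n y \<Longrightarrow> finite F \<and> inj_on fst F"
proof (induction n arbitrary: y F)
  case (Suc n)
  then consider "F = {(y, Suc n)}" | A B y' where "F = A \<union> B" "A \<in> witnesses n y"
    "B \<in> witnesses n y'" "fst ` A \<inter> fst ` B = {}" by auto
  then show ?case
  proof cases
    case 2
    then show ?thesis using Suc.IH by (auto simp: inj_on_Un)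
  qed simp
qed simp

text \<open>
  The triples \<open>(y', F, G)\<close> over which the union bound for the pairs of witnesses is taken.
\<close>

definition combinations :: "nat \<Rightarrow> int \<Rightarrow> (int \<times> (int \<times> nat) set \<times> (int \<times> nat) set) set" where
  "combinations n y = (SIGMA y' : {y'. \<bar>real_of_int (y - y')\<bar> \<le> 5 * level_scale (Suc n)}.
     witnesses n y \<times> witnesses n y')"

definition disjoint_combinations ::
    "nat \<Rightarrow> int \<Rightarrow> (int \<times> (int \<times> nat) set \<times> (int \<times> nat) set) set" where
  "disjoint_combinations n y = {c \<in> combinations n y. fst ` fst (snd c) \<inter> fst ` snd (snd c) = {}}"

lemma witnesses_Suc_subset:
  "witnesses (Suc n) y \<subseteq> insert {(y, Suc n)} ((\<lambda>c. fst (snd c) \<union> snd (snd c)) `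
     disjoint_combinations n y)"
proof
  fix A assume "A \<in> witnesses (Suc n) y"
  then consider "A = {(y, Suc n)}" | F G y' where "A = F \<union> G" "F \<in> witnesses n y"
    "G \<in> witnesses n y'" "\<bar>real_of_int (y - y')\<bar> \<le> 5 * level_scale (Suc n)"
    "fst ` F \<inter> fst ` G = {}" unfolding witnesses.simps by blast
  then show "A \<in> insert {(y, Suc n)} ((\<lambda>c. fst (snd c) \<union> snd (snd c)) ` disjoint_combinations n y)"
  proof cases
    case (2 F G y')
    then have "(y', F, G) \<in> disjoint_combinations n y"
      by (simp add: disjoint_combinations_def combinations_def)
    then show ?thesis using 2(1) by force
  qed simp
qed

lemma finite_combinations:
  assumes "\<And>y. finite (witnesses n y)" shows "finite (combinations n y)"
  unfolding combinations_def by (intro finite_SigmaI finite_cartesian_product finite_int_ball assms)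

lemma finite_witnesses: "finite (witnesses n y)"
proof (induction n arbitrary: y)
  case (Suc n)
  have "finite (disjoint_combinations n y)"
    using finite_combinations[OF Suc] by (simp add: disjoint_combinations_def)
  then have "finite (insert {(y, Suc n)} ((\<lambda>c. fst (snd c) \<union> snd (snd c)) ` disjoint_combinations n y))"
    by simp
  then show ?case by (rule finite_subset[OF witnesses_Suc_subset])
qed simp

lemma weight_nonneg: "(\<And>j. 0 \<le> t j) \<Longrightarrow> 0 \<le> weight t F"
  unfolding weight_def by (intro prod_nonneg) auto

text \<open>
  The weight is multiplicative on disjoint witnesses. So the pairs with a given \<open>y'\<close>
  contribute at most \<open>u\<^sup>2\<close>, and there are at most \<open>10 * level_scale (Suc n) + 1\<close> choices of \<open>y'\<close>.
\<close>

lemma sum_weight_witnesses_Suc: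
  assumes t: "\<And>j. 0 \<le> t j" and u: "\<And>y. (\<Sum>F\<in>witnesses n y. weight t F) \<le> u"
  shows "(\<Sum>F\<in>witnesses (Suc n) y. weight t F) \<le> t (Suc n) + (10 * level_scale (Suc n) + 1) * u\<^sup>2"
proof -
  let ?Y = "{y'. \<bar>real_of_int (y - y')\<bar> \<le> 5 * level_scale (Suc n)}"
  let ?D = "disjoint_combinations n y" and ?f = "\<lambda>c. fst (snd c) \<union> snd (snd c)"
  let ?w = "\<lambda>y. \<Sum>F\<in>witnesses n y. weight t F"
  have fin: "finite (combinations n y)" by (rule finite_combinations[OF finite_witnesses])
  then have finD: "finite ?D" by (simp add: disjoint_combinations_def)
  have w0: "0 \<le> ?w y" for y using weight_nonneg[OF t] by (simp add: sum_nonneg)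
  have u0: "0 \<le> u" using w0[of y] u[of y] by linarith
  have "(\<Sum>F\<in>witnesses (Suc n) y. weight t F) \<le> (\<Sum>F\<in>insert {(y, Suc n)} (?f ` ?D). weight t F)"
    using witnesses_Suc_subset finD weight_nonneg[OF t] by (intro sum_mono2) auto
  also have "\<dots> \<le> weight t {(y, Suc n)} + (\<Sum>F\<in>?f ` ?D. weight t F)"
    using finD weight_nonneg[OF t] by (simp add: sum.insert_if)
  also have "weight t {(y, Suc n)} = t (Suc n)" by (simp add: weight_def)
  also have "(\<Sum>F\<in>?f ` ?D. weight t F) \<le> sum (weight t \<circ> ?f) ?D"
    using finD weight_nonneg[OF t] by (rule sum_image_le)
  also have "\<dots> = (\<Sum>c\<in>?D. weight t (fst (snd c)) * weight t (snd (snd c)))"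
  proof (rule sum.cong[OF refl])
    fix c assume "c \<in> ?D"
    then have "finite (fst (snd c))" "finite (snd (snd c))" "fst (snd c) \<inter> snd (snd c) = {}"
      using witness_finite_inj by (auto simp: disjoint_combinations_def combinations_def)
    then show "(weight t \<circ> ?f) c = weight t (fst (snd c)) * weight t (snd (snd c))"
      unfolding weight_def comp_def by (rule prod.union_disjoint)
  qed
  also have "\<dots> \<le> (\<Sum>c\<in>combinations n y. weight t (fst (snd c)) * weight t (snd (snd c)))"
  proof (rule sum_mono2[OF fin])
    show "?D \<subseteq> combinations n y" by (auto simp: disjoint_combinations_def)
    show "0 \<le> weight t (fst (snd c)) * weight t (snd (snd c))" for c
      using weight_nonneg[OF t] by simp
  qed
  also have "\<dots> = (\<Sum>(y', F, G)\<in>combinations n y. weight t F * weight t G)"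
    by (simp add: case_prod_beta)
  also have "\<dots> = (\<Sum>y'\<in>?Y. \<Sum>(F, G)\<in>witnesses n y \<times> witnesses n y'. weight t F * weight t G)"
    unfolding combinations_def
    using finite_int_ball finite_witnesses by (subst sum.Sigma) (auto simp: case_prod_beta)
  also have "\<dots> = (\<Sum>y'\<in>?Y. ?w y * ?w y')"
    by (simp add: sum_product sum.cartesian_product)
  also have "\<dots> \<le> (\<Sum>y'\<in>?Y. u * u)"
    using u w0 u0 by (intro sum_mono mult_mono) auto
  also have "\<dots> = real (card ?Y) * u\<^sup>2" by (simp add: power2_eq_square)
  also have "\<dots> \<le> (10 * level_scale (Suc n) + 1) * u\<^sup>2"
    using card_int_ball[of "5 * level_scale (Suc n)" y] level_scale_pos[of "Suc n"]
    by (intro mult_right_mono) auto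
  finally show ?thesis by simp
qed

text \<open>
  The quadratic term of the recursion is at most the next tail probability, because
  \<open>level_scale (Suc n) * (\<theta> / 32) ^ (n + 3)\<close> is at most \<open>\<theta> / 8192\<close>. The exponent \<open>n + 3\<close> instead of \<open>n\<close>
  supplies the small constant that makes this work for all \<open>\<theta> < 1\<close>.
\<close>

lemma sum_weight_witnesses:
  fixes \<theta> :: real
  assumes \<theta>: "0 < \<theta>" "\<theta> < 1"
  shows "(\<Sum>F\<in>witnesses n y. weight (\<lambda>j. (\<theta> / 32) ^ (j + 3)) F) \<le> 2 * (\<theta> / 32) ^ (n + 3)"
proof (induction n arbitrary: y)
  case 0
  show ?case using \<theta> by (simp add: weight_def)
next
  case (Suc n)
  define q where "q = (\<theta> / 32) ^ (n + 3)"
  have q0: "0 < q" using \<theta> by (simp add: q_def)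
  have "level_scale (Suc n) * q = (\<theta> ^ (n + 3)) / (8 * 32 ^ 2)"
    using \<theta> by (simp add: level_scale_def q_def power_divide power_add field_simps)
  also have "\<theta> ^ (n + 3) \<le> \<theta>" using \<theta> power_decreasing[of 1 "n + 3" \<theta>] by simp
  finally have s: "level_scale (Suc n) * q \<le> \<theta> / 8192" by simp
  have "(1::real) \<le> 32 ^ n" by simp
  then have "(1::real) \<le> 4 * 32 ^ n" by linarith
  then have "10 * level_scale (Suc n) + 1 \<le> 11 * level_scale (Suc n)" by (simp add: level_scale_def)
  then have "(10 * level_scale (Suc n) + 1) * (2 * q)\<^sup>2 \<le> 11 * level_scale (Suc n) * (2 * q)\<^sup>2"
    by (intro mult_right_mono) auto
  also have "\<dots> = 44 * (level_scale (Suc n) * q) * q" by (simp add: power2_eq_square)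
  also have "\<dots> \<le> 44 * (\<theta> / 8192) * q" using s q0 by (intro mult_right_mono mult_left_mono) auto
  also have "\<dots> \<le> \<theta> / 32 * q" using q0 \<theta> by (intro mult_right_mono) auto
  finally have "(10 * level_scale (Suc n) + 1) * (2 * q)\<^sup>2 \<le> \<theta> / 32 * q" .
  moreover have "(\<Sum>F\<in>witnesses (Suc n) y. weight (\<lambda>j. (\<theta> / 32) ^ (j + 3)) F) \<le>
      (\<theta> / 32) ^ (Suc n + 3) + (10 * level_scale (Suc n) + 1) * (2 * q)\<^sup>2"
    using \<theta> Suc.IH by (intro sum_weight_witnesses_Suc) (auto simp: q_def)
  moreover have "(\<theta> / 32) ^ (Suc n + 3) = \<theta> / 32 * q"
    unfolding q_def add_Suc power_Suc ..
  ultimately show ?case by linarith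
qed

definition occurs :: "(int \<times> nat) set \<Rightarrow> (int \<Rightarrow> real) \<Rightarrow> bool" where
  "occurs F r \<longleftrightarrow> (\<forall>(z, j)\<in>F. level_scale j / 16 < r z)"

lemma
  assumes rd: "real_distribution P" and F: "finite F" "inj_on fst F"
    and t: "\<And>j. measure P {level_scale j / 16<..} \<le> t j"
  defines "M \<equiv> \<Pi>\<^sub>M i\<in>(UNIV :: int set). P"
  shows sets_occurs: "{r \<in> space M. occurs F r} \<in> sets M"
    and measure_occurs: "measure M {r \<in> space M. occurs F r} \<le> weight t F"
proof -
  interpret D: real_distribution P by fact
  interpret product_prob_space "\<lambda>_. P" "UNIV :: int set" by standard
  \<comment> \<open>A witness imposes at most one requirement on each red interval.\<close>
  define X where "X z = {level_scale (snd (inv_into F fst z)) / 16<..}" for z :: int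
  have X: "X (fst zj) = {level_scale (snd zj) / 16<..}" if "zj \<in> F" for zj
    using F(2) that by (simp add: X_def)
  have *: "{r \<in> space M. occurs F r} = {r \<in> space M. \<forall>z\<in>fst ` F. r z \<in> X z}"
    using X by (auto simp: occurs_def)
  show "{r \<in> space M. occurs F r} \<in> sets M"
    unfolding occurs_def M_def case_prod_beta using F(1) by measurable
  have "emeasure M {r \<in> space M. occurs F r} = (\<Prod>z\<in>fst ` F. emeasure P (X z))"
    unfolding * unfolding M_def using F by (intro emeasure_PiM_Collect) (auto simp: X_def)
  also have "\<dots> = ennreal (\<Prod>z\<in>fst ` F. measure P (X z))"
    by (simp add: D.emeasure_eq_measure prod_ennreal)
  finally have "measure M {r \<in> space M. occurs F r} = (\<Prod>z\<in>fst ` F. measure P (X z))"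
    by (simp add: measure_def prod_nonneg)
  also have "\<dots> = (\<Prod>zj\<in>F. measure P {level_scale (snd zj) / 16<..})"
    using F(2) X by (subst prod.reindex) auto
  also have "\<dots> \<le> (\<Prod>zj\<in>F. t (snd zj))"
    using t by (intro prod_mono) auto
  also have "\<dots> = weight t F" by (simp add: weight_def case_prod_beta)
  finally show "measure M {r \<in> space M. occurs F r} \<le> weight t F" .
qed

text \<open>
  The radius is chosen for a survivor \<open>w\<close> of round \<open>n\<close> within distance \<open>level_scale (Suc n)\<close> of \<open>x\<close>: its
  witness is attached to a site \<open>y\<close> within \<open>5 * level_scale n\<close> of \<open>w\<close>, and \<open>32 + 5 = 37\<close>.
  There are about \<open>32 ^ n\<close> such sites, so the probabilities to be summed are of order \<open>\<theta> ^ n\<close>.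
\<close>

lemma AE_no_witness_near:
  fixes x :: int
  assumes rd: "real_distribution P" and \<theta>: "0 < \<theta>" "\<theta> < 1"
    and tail: "\<And>j. measure P {level_scale j / 16<..} \<le> (\<theta> / 32) ^ (j + 3)"
  shows "AE r in \<Pi>\<^sub>M i\<in>(UNIV :: int set). P. \<forall>\<^sub>F n in sequentially.
    \<forall>y. \<bar>real_of_int (x - y)\<bar> \<le> 37 * level_scale n \<longrightarrow> (\<forall>F\<in>witnesses n y. \<not> occurs F r)"
proof -
  define M where "M = (\<Pi>\<^sub>M i\<in>(UNIV :: int set). P)"
  interpret D: real_distribution P by fact
  interpret product_prob_space "\<lambda>_. P" "UNIV :: int set" by standard
  interpret M: prob_space M unfolding M_def by (rule D.prob_space_axioms[THEN prob_space_PiM])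
  define Y where "Y n = {y. \<bar>real_of_int (x - y)\<bar> \<le> 37 * level_scale n}" for n
  define A where "A n = (\<Union>y\<in>Y n. \<Union>F\<in>witnesses n y. {r \<in> space M. occurs F r})" for n
  have meas: "{r \<in> space M. occurs F r} \<in> sets M"
    and prob: "measure M {r \<in> space M. occurs F r} \<le> weight (\<lambda>j. (\<theta> / 32) ^ (j + 3)) F"
    if "F \<in> witnesses n y" for F n y
    using sets_occurs[OF rd _ _ tail] measure_occurs[OF rd _ _ tail] witness_finite_inj[OF that]
    unfolding M_def by auto
  have finY: "finite (Y n)" for n unfolding Y_def by (rule finite_int_ball)
  have setsA: "A n \<in> sets M" for n
    unfolding A_def using finY finite_witnesses meas by (intro sets.finite_UN) auto
  have boundA: "measure M (A n) \<le> \<theta> ^ n" for n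
  proof -
    have "measure M (A n) \<le> (\<Sum>y\<in>Y n. measure M (\<Union>F\<in>witnesses n y. {r \<in> space M. occurs F r}))"
      unfolding A_def using finY finite_witnesses meas
      by (intro M.finite_measure_subadditive_finite) (auto intro!: sets.finite_UN)
    also have "\<dots> \<le> (\<Sum>y\<in>Y n. \<Sum>F\<in>witnesses n y. measure M {r \<in> space M. occurs F r})"
      using finite_witnesses meas
      by (intro sum_mono M.finite_measure_subadditive_finite) auto
    also have "\<dots> \<le> (\<Sum>y\<in>Y n. \<Sum>F\<in>witnesses n y. weight (\<lambda>j. (\<theta> / 32) ^ (j + 3)) F)"
      using prob by (intro sum_mono) auto
    also have "\<dots> \<le> (\<Sum>y\<in>Y n. 2 * (\<theta> / 32) ^ (n + 3))"
      by (intro sum_mono sum_weight_witnesses \<theta>)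
    also have "\<dots> = real (card (Y n)) * (2 * (\<theta> / 32) ^ (n + 3))" by simp
    also have "\<dots> \<le> (82 * level_scale n) * (2 * (\<theta> / 32) ^ (n + 3))"
    proof (rule mult_right_mono)
      have "real (card (Y n)) \<le> 2 * (37 * level_scale n) + 1"
        unfolding Y_def using level_scale_pos[of n] by (intro card_int_ball) auto
      moreover have "1 \<le> 8 * level_scale n" by (simp add: level_scale_def)
      ultimately show "real (card (Y n)) \<le> 82 * level_scale n" by linarith
    qed (use \<theta> in auto)
    also have "\<dots> = 164 / 8 / 32 ^ 3 * \<theta> ^ 3 * \<theta> ^ n"
      by (simp add: level_scale_def power_divide power_add)
    also have "\<dots> \<le> 1 * \<theta> ^ n"
      using \<theta> power_le_one[of \<theta> 3] by (intro mult_right_mono) auto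
    finally show ?thesis by simp
  qed
  have "summable (\<lambda>n. measure M (A n))"
    using boundA \<theta> by (intro summable_comparison_test'[OF summable_geometric[of \<theta>], of 0]) auto
  then have "AE r in M. \<forall>\<^sub>F n in sequentially. r \<in> space M - A n"
    using setsA by (intro borel_cantelli_AE1) (auto simp: M.emeasure_eq_measure)
  then have "AE r in M. \<forall>\<^sub>F n in sequentially. \<forall>y. \<bar>real_of_int (x - y)\<bar> \<le> 37 * level_scale n \<longrightarrow>
      (\<forall>F\<in>witnesses n y. \<not> occurs F r)"
  proof (rule AE_mp, intro AE_I2 impI)
    fix r assume r: "r \<in> space M" "\<forall>\<^sub>F n in sequentially. r \<in> space M - A n"
    from r(2) show "\<forall>\<^sub>F n in sequentially. \<forall>y. \<bar>real_of_int (x - y)\<bar> \<le> 37 * level_scale n \<longrightarrow>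
      (\<forall>F\<in>witnesses n y. \<not> occurs F r)"
      by (rule eventually_mono) (use r(1) in \<open>auto simp: A_def Y_def\<close>)
  qed
  then show ?thesis unfolding M_def .
qed

section \<open>From sparse long red intervals to the victory of blue\<close>

lemma boundaries_Suc: "boundaries r b (k + 1) = boundaries r b k + gap r b k"
proof (cases "0 \<le> k")
  case True
  then have "{0..<k + 1} = insert k {0..<k}" by auto
  then show ?thesis using True by (simp add: boundaries_def)
next
  case False
  then have k: "{k..<0} = insert k {k + 1..<0}" by auto
  have "boundaries r b (k + 1) = - (\<Sum>j\<in>{k + 1..<0}. gap r b j)"
    using False by (cases "k + 1 = 0") (auto simp: boundaries_def)
  then show ?thesis using False k by (simp add: boundaries_def)
qed

lemma boundaries_diff:
  assumes "i \<le> j" shows "boundaries r b j - boundaries r b i = (\<Sum>k\<in>{i..<j}. gap r b k)"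
  using assms
proof (induction j rule: int_ge_induct)
  case (step j)
  then have "{i..<j + 1} = insert j {i..<j}" by auto
  then show ?case using step by (simp add: boundaries_Suc)
qed simp

lemma spaced_red_intervals:
  assumes "\<And>i. 0 < r i" "\<And>i. 1 \<le> b i"
  shows "spaced_intervals (\<lambda>x. boundaries r b (2 * x - 1)) (\<lambda>x. boundaries r b (2 * x))"
proof
  fix x :: int
  show "boundaries r b (2 * x - 1) < boundaries r b (2 * x)"
    using boundaries_Suc[of r b "2 * x - 1"] assms(1)[of x] by (simp add: gap_def)
  show "boundaries r b (2 * x) + 1 \<le> boundaries r b (2 * (x + 1) - 1)"
    using boundaries_Suc[of r b "2 * x"] assms(2)[of x] by (simp add: gap_def add.commute)
qed

lemma boundary_seq_boundaries:
  assumes r: "\<And>i. 0 < r i" and b: "\<And>i. 1 \<le> b i"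
  shows "boundary_seq (boundaries r b)"
proof -
  let ?P = "boundaries r b"
  interpret spaced_intervals "\<lambda>x. ?P (2 * x - 1)" "\<lambda>x. ?P (2 * x)"
    by (rule spaced_red_intervals[OF r b])
  have "0 < b i" for i using b[of i] by linarith
  then have pos: "0 < gap r b k" for k using r by (simp add: gap_def)
  have "strict_mono ?P"
  proof (rule strict_monoI)
    fix i j :: int assume "i < j"
    then have "0 < (\<Sum>k\<in>{i..<j}. gap r b k)" using pos by (intro sum_pos) auto
    then show "?P i < ?P j" using boundaries_diff[of i j r b] \<open>i < j\<close> by simp
  qed
  moreover have "\<exists>i. ?P i < x \<and> x \<le> ?P (i + 1)" for x
  proof (rule ccontr)
    assume "\<nexists>i. ?P i < x \<and> x \<le> ?P (i + 1)"
    then have step: "?P (i + 1) < x" if "?P i < x" for i using that by force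
    define m where "m = min (-1) (\<lfloor>x - ?P (- 1)\<rfloor> - 1)"
    have "?P (2 * m) + real_of_int (0 - m) \<le> ?P (2 * 0 - 1)"
      by (rule spacing_trans) (simp add: m_def)
    moreover have "real_of_int m < x - ?P (- 1)"
      unfolding m_def by linarith
    ultimately have base: "?P (2 * m) < x" by simp
    have all: "?P i < x" if "2 * m \<le> i" for i
      using that by (induction i rule: int_ge_induct) (use base step in auto)
    define M where "M = max 1 (\<lceil>x - ?P 0\<rceil>)"
    have "?P (2 * 0) + real_of_int (M - 0) \<le> ?P (2 * M - 1)"
      by (rule spacing_trans) (simp add: M_def)
    moreover have "x - ?P 0 \<le> real_of_int M"
      unfolding M_def by linarith
    ultimately have "x \<le> ?P (2 * M - 1)" by simp
    moreover have "2 * m \<le> 2 * M - 1" by (simp add: m_def M_def)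
    ultimately show False using all[of "2 * M - 1"] by simp
  qed
  ultimately show ?thesis unfolding boundary_seq_def by (auto simp: set_eq_iff)
qed

text \<open>
  This joins the two halves: without witnesses near \<open>x\<close> there are no survivors near \<open>x\<close> in late rounds,
  so \<open>x\<close> is covered by a maximal hull.
\<close>

lemma finally_blue_if_no_witness:
  assumes r: "\<And>i. 0 < r i" and b: "\<And>i. 1 \<le> b i"
    and ties: "\<And>i j k. i < j \<Longrightarrow> j < k \<Longrightarrow>
      boundaries r b j - boundaries r b i \<noteq> boundaries r b k - boundaries r b j"
    and rare: "\<And>x. \<forall>\<^sub>F n in sequentially. \<forall>y. \<bar>real_of_int (x - y)\<bar> \<le> 37 * level_scale n \<longrightarrow>
      (\<forall>F\<in>witnesses n y. \<not> occurs F r)"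
    and J: "complete_recolouring_seq (colouring_of (boundaries r b)) N J"
  shows "finally_blue (colouring_of (boundaries r b)) N J x"
proof -
  let ?P = "boundaries r b"
  interpret spaced_intervals "\<lambda>x. ?P (2 * x - 1)" "\<lambda>x. ?P (2 * x)"
    by (rule spaced_red_intervals[OF r b])
  have len: "len z = r z" for z
    using boundaries_Suc[of r b "2 * z - 1"] by (simp add: len_def gap_def)
  interpret isolated_hulls ?P maximal_hulls
  proof
    show "boundary_seq ?P" by (rule boundary_seq_boundaries[OF r b])
    show "?P j - ?P i \<noteq> ?P k - ?P j" if "i < j" "j < k" for i j k using ties that .
    show "l < h" if "(n, l, h) \<in> maximal_hulls" for n l h using maximal_hulls_less that .
    show "l = l' \<and> h = h' \<or> h - l \<le> l' - h \<or> h - l \<le> l - h'"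
      if "(n, l, h) \<in> maximal_hulls" "(m, l', h') \<in> maximal_hulls" "n \<le> m" for n l h m l' h'
      using maximal_hulls_isolated that .
    fix x :: int
    obtain n0 where n0: "\<And>n y F. n0 \<le> n \<Longrightarrow> \<bar>real_of_int (x - y)\<bar> \<le> 37 * level_scale n \<Longrightarrow>
        F \<in> witnesses n y \<Longrightarrow> \<not> occurs F r"
      using rare[of x] unfolding eventually_sequentially by blast
    show "\<exists>n l h. (n, l, h) \<in> maximal_hulls \<and> l \<le> ?P (2 * x - 1) \<and> ?P (2 * x) \<le> h"
    proof (rule maximal_hulls_cover)
      fix n w assume n: "Suc n0 \<le> n" and w: "w \<in> survivors n"
      then obtain m where m: "n = Suc m" "n0 \<le> m" by (cases n) auto
      obtain y F where F: "F \<in> witnesses m y" "gap_between w y \<le> 5 * level_scale m"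
        "\<forall>(z, j)\<in>F. level_scale j / 16 < len z \<and> gap_between y z \<le> 6 * level_scale m"
        using survivors_witness w m by blast
      have "occurs F r" using F(3) by (auto simp: occurs_def len)
      then have "37 * level_scale m < \<bar>real_of_int (x - y)\<bar>" using n0[OF m(2) _ F(1)] by force
      moreover have "\<bar>real_of_int (w - y)\<bar> \<le> 5 * level_scale m"
        using index_distance_le_gap[of w y] F(2) by linarith
      ultimately have "32 * level_scale m < \<bar>real_of_int (x - w)\<bar>" by linarith
      then show "level_scale n < gap_between x w"
        using index_distance_le_gap[of x w] unfolding m level_scale_Suc by linarith
    qed
  qed
  show ?thesis by (rule finally_blue_all[OF J])
qed

section \<open>Ties have probability zero\<close>

text \<open>
  Fubini for a single coordinate: the coordinate \<open>e\<close> may be replaced by an independent copy.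
\<close>

lemma AE_PiM_resample:
  assumes P: "prob_space P" and meas: "{b \<in> space (\<Pi>\<^sub>M i\<in>(UNIV :: int set). P). Q b} \<in>
      sets (\<Pi>\<^sub>M i\<in>(UNIV :: int set). P)"
    and Q: "\<And>b. AE x in P. Q (b(e := x))"
  shows "AE b in \<Pi>\<^sub>M i\<in>(UNIV :: int set). P. Q b"
proof -
  let ?U = "\<Pi>\<^sub>M i\<in>(UNIV :: int set). P" and ?V = "\<Pi>\<^sub>M i\<in>(UNIV - {e}). P"
  interpret P: prob_space P by fact
  interpret V: prob_space ?V using P by (rule prob_space_PiM)
  interpret PV: pair_prob_space P ?V ..
  have U: "?U = distr (P \<Otimes>\<^sub>M ?V) ?U (\<lambda>(x, X). X(e := x))"
    using distr_pair_PiM_eq_PiM[of "UNIV - {e}" "\<lambda>_. P" e] P by (simp add: insert_absorb)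
  have f: "(\<lambda>(x, X). X(e := x)) \<in> P \<Otimes>\<^sub>M ?V \<rightarrow>\<^sub>M ?U"
    using measurable_add_dim[of e "UNIV - {e}" "\<lambda>_. P"] by simp
  let ?f = "\<lambda>(x, X). X(e := x)"
  have "{z \<in> space (P \<Otimes>\<^sub>M ?V). Q ((snd z)(e := fst z))} =
      ?f -` {b \<in> space ?U. Q b} \<inter> space (P \<Otimes>\<^sub>M ?V)"
    using measurable_space[OF f] by (auto simp: case_prod_beta)
  then have m: "{z \<in> space (P \<Otimes>\<^sub>M ?V). Q ((snd z)(e := fst z))} \<in> sets (P \<Otimes>\<^sub>M ?V)"
    using measurable_sets[OF f meas] by simp
  have "AE x in P. AE X in ?V. Q (X(e := x))"
    using Q by (subst PV.AE_commute) (use m in auto)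
  then have "AE z in P \<Otimes>\<^sub>M ?V. Q ((snd z)(e := fst z))"
    using m by (intro PV.AE_pair_measure) auto
  then have "AE z in P \<Otimes>\<^sub>M ?V. Q ((\<lambda>(x, X). X(e := x)) z)" by (simp add: case_prod_beta)
  then show ?thesis
    by (subst U) (simp add: AE_distr_iff[OF f meas])
qed

lemma gap_sum_update:
  "(\<Sum>k\<in>{i..<j}. gap r (b(e := x)) k) =
     (if 2 * e \<in> {i..<j} then x else 0) + (\<Sum>k\<in>{i..<j} - {2 * e}. gap r b k)"
proof -
  have "(\<Sum>k\<in>{i..<j} - {2 * e}. gap r (b(e := x)) k) = (\<Sum>k\<in>{i..<j} - {2 * e}. gap r b k)"
  proof (rule sum.cong[OF refl])
    fix k assume "k \<in> {i..<j} - {2 * e}"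
    then have "even k \<Longrightarrow> k div 2 \<noteq> e" by auto
    then show "gap r (b(e := x)) k = gap r b k" by (simp add: gap_def)
  qed
  moreover have "gap r (b(e := x)) (2 * e) = x" by (simp add: gap_def)
  moreover have "(\<Sum>k\<in>{i..<j}. gap r (b(e := x)) k) = (if 2 * e \<in> {i..<j} then x else 0) +
      (\<Sum>k\<in>{i..<j} - {2 * e}. gap r (b(e := x)) k)"
    using sum.remove[of "{i..<j}" "2 * e" "gap r (b(e := x))"] calculation(2) by auto
  ultimately show ?thesis by simp
qed

text \<open>
  Two adjacent intervals bounded by initial boundary-points together contain at least one initial blue
  interval \<open>e\<close>. Given all other lengths, exactly one value of the length of \<open>e\<close> produces a tie.
\<close>

lemma AE_no_tie:
  fixes i j k :: int
  assumes R: "real_distribution P_R" and B: "real_distribution P_B" and na: "non_atomic P_B"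
    and ijk: "i < j" "j < k"
  shows "AE (r, b) in (\<Pi>\<^sub>M i\<in>(UNIV :: int set). P_R) \<Otimes>\<^sub>M (\<Pi>\<^sub>M i\<in>(UNIV :: int set). P_B).
    boundaries r b j - boundaries r b i \<noteq> boundaries r b k - boundaries r b j"
proof -
  interpret R: real_distribution P_R by fact
  interpret B: real_distribution P_B by fact
  let ?R = "\<Pi>\<^sub>M i\<in>(UNIV :: int set). P_R" and ?B = "\<Pi>\<^sub>M i\<in>(UNIV :: int set). P_B"
  interpret PR: prob_space ?R by (rule prob_space_PiM) (rule R.prob_space_axioms)
  interpret PB: prob_space ?B by (rule prob_space_PiM) (rule B.prob_space_axioms)
  interpret pair_prob_space ?R ?B ..
  define D where "D r b = (\<Sum>m\<in>{i..<j}. gap r b m) - (\<Sum>m\<in>{j..<k}. gap r b m)" for r b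
  have gap_meas[measurable]: "(\<lambda>z. gap (fst z) (snd z) m) \<in> borel_measurable (?R \<Otimes>\<^sub>M ?B)" for m
    unfolding gap_def by (cases "even m") simp_all
  have Dm: "(\<lambda>z. D (fst z) (snd z)) \<in> borel_measurable (?R \<Otimes>\<^sub>M ?B)"
    unfolding D_def by measurable
  have gap_meas'[measurable]: "(\<lambda>b. gap r b m) \<in> borel_measurable ?B" for r m
    unfolding gap_def by (cases "even m") simp_all
  have Dm': "(\<lambda>b. D r b) \<in> borel_measurable ?B" for r
    unfolding D_def by measurable
  obtain e where e: "2 * e \<in> {i..<k}"
  proof -
    have "2 * ((i + 1) div 2) \<in> {i..<k}" using ijk by auto
    then show ?thesis using that by blast
  qed
  have "AE b in ?B. D r b \<noteq> 0" for r
  proof (rule AE_PiM_resample[OF B.prob_space_axioms, where e = e])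
    show "{b \<in> space ?B. D r b \<noteq> 0} \<in> sets ?B" using Dm'[of r] by measurable
    fix b
    define s where "s = (\<Sum>m\<in>{i..<j} - {2 * e}. gap r b m) - (\<Sum>m\<in>{j..<k} - {2 * e}. gap r b m)"
    have "D r (b(e := x)) = (if 2 * e < j then x else - x) + s" for x
      unfolding D_def gap_sum_update s_def using e ijk by auto
    moreover define c where "c = (if 2 * e < j then - s else s)"
    ultimately have D: "x \<noteq> c \<Longrightarrow> D r (b(e := x)) \<noteq> 0" for x by (auto split: if_splits)
    have "{c} \<in> null_sets P_B"
      using na by (intro null_setsI) (auto simp: non_atomic_def B.emeasure_eq_measure)
    then have "AE x in P_B. x \<notin> {c}" by (rule AE_not_in)
    then show "AE x in P_B. D r (b(e := x)) \<noteq> 0"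
      by (rule AE_mp) (simp add: D)
  qed
  then have "AE z in ?R \<Otimes>\<^sub>M ?B. D (fst z) (snd z) \<noteq> 0"
    using Dm by (intro AE_pair_measure) (auto intro!: AE_I2)
  then show ?thesis
    by (rule AE_mp) (use boundaries_diff ijk in \<open>auto simp: D_def\<close>)
qed


section \<open>The two distributions\<close>

lemma (in prob_space) distr_pair_snd:
  assumes N: "prob_space N" shows "distr (M \<Otimes>\<^sub>M N) N snd = N"
proof (rule measure_eqI)
  interpret N: prob_space N by fact
  fix A assume A: "A \<in> sets (distr (M \<Otimes>\<^sub>M N) N snd)"
  then have "emeasure (distr (M \<Otimes>\<^sub>M N) N snd) A = emeasure (M \<Otimes>\<^sub>M N) (space M \<times> A)"
    by (auto simp: emeasure_distr space_pair_measure dest: sets.sets_into_space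
        intro!: arg_cong2[where f = emeasure])
  then show "emeasure (distr (M \<Otimes>\<^sub>M N) N snd) A = emeasure N A"
    using A by (simp add: N.emeasure_pair_measure_Times emeasure_space_1)
qed simp

lemma blue_wins_almost_surelyI:
  assumes R: "real_distribution P_R" "AE x in P_R. 0 < x"
    and B: "real_distribution P_B" "AE x in P_B. 1 \<le> x" "non_atomic P_B"
    and \<theta>: "0 < \<theta>" "\<theta> < 1"
    and tail: "\<And>j. measure P_R {level_scale j / 16<..} \<le> (\<theta> / 32) ^ (j + 3)"
  shows "blue_wins_almost_surely P_R P_B"
proof -
  interpret R: real_distribution P_R by fact
  interpret B: real_distribution P_B by fact
  let ?R = "\<Pi>\<^sub>M i\<in>(UNIV :: int set). P_R" and ?B = "\<Pi>\<^sub>M i\<in>(UNIV :: int set). P_B"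
  interpret PR: prob_space ?R by (rule prob_space_PiM) (rule R.prob_space_axioms)
  interpret PB: prob_space ?B by (rule prob_space_PiM) (rule B.prob_space_axioms)
  interpret pair_prob_space ?R ?B ..
  have fst: "AE z in ?R \<Otimes>\<^sub>M ?B. Q (fst z)" if "AE r in ?R. Q r" for Q
  proof (rule AE_distrD[of fst "?R \<Otimes>\<^sub>M ?B" ?R Q])
    show "AE r in distr (?R \<Otimes>\<^sub>M ?B) ?R fst. Q r"
      unfolding prob_space.distr_pair_fst[OF PB.prob_space_axioms] by (rule that)
  qed simp
  have snd: "AE z in ?R \<Otimes>\<^sub>M ?B. Q (snd z)" if "AE b in ?B. Q b" for Q
  proof (rule AE_distrD[of snd "?R \<Otimes>\<^sub>M ?B" ?B Q])
    show "AE b in distr (?R \<Otimes>\<^sub>M ?B) ?B snd. Q b"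
      unfolding prob_space.distr_pair_snd[OF PR.prob_space_axioms PB.prob_space_axioms] by (rule that)
  qed simp
  have pos: "AE z in ?R \<Otimes>\<^sub>M ?B. \<forall>i. 0 < fst z i"
    unfolding AE_all_countable
    by (intro allI fst AE_PiM_component R.prob_space_axioms R(2)) auto
  have ge1: "AE z in ?R \<Otimes>\<^sub>M ?B. \<forall>i. 1 \<le> snd z i"
    unfolding AE_all_countable
    by (intro allI snd AE_PiM_component B.prob_space_axioms B(2)) auto
  have rare: "AE z in ?R \<Otimes>\<^sub>M ?B. \<forall>x. \<forall>\<^sub>F n in sequentially. \<forall>y.
      \<bar>real_of_int (x - y)\<bar> \<le> 37 * level_scale n \<longrightarrow> (\<forall>F\<in>witnesses n y. \<not> occurs F (fst z))"
    unfolding AE_all_countable by (intro allI fst AE_no_witness_near[OF R(1) \<theta> tail])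
  have ties: "AE z in ?R \<Otimes>\<^sub>M ?B. \<forall>i j k. i < j \<longrightarrow> j < k \<longrightarrow>
      boundaries (fst z) (snd z) j - boundaries (fst z) (snd z) i \<noteq>
      boundaries (fst z) (snd z) k - boundaries (fst z) (snd z) j"
    unfolding AE_all_countable
  proof (intro allI)
    fix i j k :: int
    show "AE z in ?R \<Otimes>\<^sub>M ?B. i < j \<longrightarrow> j < k \<longrightarrow>
      boundaries (fst z) (snd z) j - boundaries (fst z) (snd z) i \<noteq>
      boundaries (fst z) (snd z) k - boundaries (fst z) (snd z) j"
      using AE_no_tie[OF R(1) B(1,3), of i j k]
      by (cases "i < j \<and> j < k") (auto simp: case_prod_beta)
  qed
  from pos ge1 rare ties have "AE z in ?R \<Otimes>\<^sub>M ?B. \<forall>N J.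
      complete_recolouring_seq (colouring_of (boundaries (fst z) (snd z))) N J \<longrightarrow>
      (\<forall>x. finally_blue (colouring_of (boundaries (fst z) (snd z))) N J x)"
  proof eventually_elim
    case (elim z)
    show ?case
    proof (intro allI impI)
      fix N J x
      assume "complete_recolouring_seq (colouring_of (boundaries (fst z) (snd z))) N J"
      then show "finally_blue (colouring_of (boundaries (fst z) (snd z))) N J x"
      proof (rule finally_blue_if_no_witness[rotated 4])
        show "0 < fst z i" "1 \<le> snd z i" for i using elim(1,2) by simp_all
        show "boundaries (fst z) (snd z) j - boundaries (fst z) (snd z) i \<noteq>
            boundaries (fst z) (snd z) k - boundaries (fst z) (snd z) j" if "i < j" "j < k" for i j k
          using elim(4) that by blast
      qed (use elim(3) in simp)
    qed
  qed
  then show ?thesis unfolding blue_wins_almost_surely_def case_prod_beta .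
qed

lemma geometric_pmf_tail:
  assumes p: "0 < p" "p \<le> 1"
  shows "measure (measure_pmf (geometric_pmf p)) {n..} = (1 - p) ^ n"
proof -
  have "measure (measure_pmf (geometric_pmf p)) {n..} = 1 - measure (measure_pmf (geometric_pmf p)) {..<n}"
    using measure_pmf.prob_compl[of "{..<n}" "geometric_pmf p"] by (simp add: Compl_eq_Diff_UNIV[symmetric])
  also have "measure (measure_pmf (geometric_pmf p)) {..<n} = (\<Sum>k<n. (1 - p) ^ k * p)"
    using p by (subst measure_measure_pmf_finite) auto
  also have "\<dots> = p * (\<Sum>k<n. (1 - p) ^ k)" by (simp add: sum_distrib_left mult.commute)
  also have "\<dots> = 1 - (1 - p) ^ n" using one_diff_power_eq[of "1 - p" n] by simp
  finally show ?thesis by simp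
qed

text \<open>
  The parameter of the geometric distribution makes \<open>(\<theta> / 32) ^ k\<close> the probability of an index at
  least \<open>k\<close>. The factor \<open>1 / 2 ^ 17\<close> is chosen so that a length exceeds \<open>level_scale j / 16 = 32 ^ j / 2 ^ 7\<close>
  only if its index is at least \<open>j + 3\<close>.
\<close>

definition pareto :: "real \<Rightarrow> real measure" where
  "pareto \<theta> = distr (measure_pmf (geometric_pmf (1 - \<theta> / 32))) borel (\<lambda>k. 32 ^ k / 2 ^ 17)"

context
  fixes \<theta> :: real
  assumes \<theta>: "0 < \<theta>" "\<theta> < 1"
begin

lemma real_distribution_pareto: "real_distribution (pareto \<theta>)"
  unfolding pareto_def real_distribution_def real_distribution_axioms_def
  by (auto intro!: measure_pmf.prob_space_distr)

lemma pareto_positive: "AE x in pareto \<theta>. 0 < x"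
  unfolding pareto_def by (subst AE_distr_iff) auto

lemma pareto_tail: "measure (pareto \<theta>) {level_scale j / 16<..} \<le> (\<theta> / 32) ^ (j + 3)"
proof -
  have "k \<ge> j + 3" if "level_scale j / 16 < 32 ^ k / 2 ^ 17" for k
  proof -
    have "(32::real) ^ (j + 2) < 32 ^ k" using that by (simp add: level_scale_def power_add)
    then have "j + 2 < k" by (rule power_less_imp_less_exp[rotated]) simp
    then show ?thesis by simp
  qed
  then have "(\<lambda>k. 32 ^ k / 2 ^ 17) -` {level_scale j / 16<..} \<subseteq> {j + 3..}" by auto
  then have "measure (pareto \<theta>) {level_scale j / 16<..} \<le>
      measure (measure_pmf (geometric_pmf (1 - \<theta> / 32))) {j + 3..}"
    unfolding pareto_def by (subst measure_distr) (auto intro!: measure_pmf.finite_measure_mono)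
  also have "\<dots> = (\<theta> / 32) ^ (j + 3)" using \<theta> by (subst geometric_pmf_tail) auto
  finally show ?thesis .
qed

lemma
  shows integrable_pareto: "integrable (pareto \<theta>) (\<lambda>x. x)"
    and mean_pareto: "(\<integral>x. x \<partial>pareto \<theta>) = (1 - \<theta> / 32) / (2 ^ 17 * (1 - \<theta>))"
proof -
  let ?p = "1 - \<theta> / 32"
  let ?g = "\<lambda>k. pmf (geometric_pmf ?p) k * (32 ^ k / 2 ^ 17)"
  have g: "?g k = ?p / 2 ^ 17 * \<theta> ^ k" for k
    using \<theta> by (simp add: power_divide)
  have sums: "?g sums (?p / 2 ^ 17 * (1 / (1 - \<theta>)))"
    unfolding g using \<theta> by (intro sums_mult geometric_sums) auto
  have nonneg: "0 \<le> ?g k" for k by simp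
  have int: "integrable (count_space UNIV) ?g"
    unfolding integrable_count_space_nat_iff using sums nonneg by (simp add: sums_iff)
  show "integrable (pareto \<theta>) (\<lambda>x. x)"
    unfolding pareto_def measure_pmf_eq_density using int
    by (subst integrable_distr_eq) (auto simp: integrable_density)
  have "(\<integral>x. x \<partial>pareto \<theta>) = (\<integral>k. ?g k \<partial>count_space UNIV)"
    unfolding pareto_def measure_pmf_eq_density
    by (subst integral_distr) (auto simp: integral_density)
  also have "\<dots> = ?p / 2 ^ 17 * (1 / (1 - \<theta>))"
    using int sums by (subst integral_count_space_nat) (auto simp: sums_iff)
  finally show "(\<integral>x. x \<partial>pareto \<theta>) = (1 - \<theta> / 32) / (2 ^ 17 * (1 - \<theta>))" by simp
qed

end

abbreviation unit_uniform :: "real measure" where "unit_uniform \<equiv> uniform_measure lborel {1..2}"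

lemma real_distribution_unit_uniform: "real_distribution unit_uniform"
  unfolding real_distribution_def real_distribution_axioms_def
  by (auto intro!: prob_space_uniform_measure)

lemma AE_unit_uniform: "AE x in unit_uniform. 1 \<le> x \<and> x \<le> 2"
  by (intro AE_uniform_measureI) auto

lemma non_atomic_unit_uniform: "non_atomic unit_uniform"
  unfolding non_atomic_def
proof
  fix x :: real
  have "emeasure lborel ({1..2} \<inter> {x}) \<le> emeasure lborel {x}" by (intro emeasure_mono) auto
  then have "emeasure lborel ({1..2} \<inter> {x}) = 0" by simp
  then show "measure unit_uniform {x} = 0" by (simp add: measure_def)
qed

lemma
  shows integrable_unit_uniform: "integrable unit_uniform (\<lambda>x. x)"
    and mean_unit_uniform: "(\<integral>x. x \<partial>unit_uniform) \<le> 2"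
proof -
  interpret real_distribution unit_uniform by (rule real_distribution_unit_uniform)
  show int: "integrable unit_uniform (\<lambda>x. x)"
    using AE_unit_uniform by (intro integrable_const_bound[of _ 2]) auto
  show "(\<integral>x. x \<partial>unit_uniform) \<le> 2"
    using AE_unit_uniform by (intro integral_le_const int) auto
qed

theorem theorem2p2:
  fixes K :: real
  assumes "K > 0"
  shows "\<exists>P_R P_B :: real measure.
           distribution_on_positive_reals P_R \<and> distribution_on_positive_reals P_B \<and>
           integrable P_R (\<lambda>x. x) \<and> integrable P_B (\<lambda>x. x) \<and>
           (non_atomic P_R \<or> non_atomic P_B) \<and>
           (\<integral>x. x \<partial>P_R) > K * (\<integral>x. x \<partial>P_B) \<and>
           blue_wins_almost_surely P_R P_B"
proof -
  \<comment> \<open>The mean red length is at least \<open>1 / (2 ^ 18 d) = 4 (K + 1)\<close>, the mean blue length at most \<open>2\<close>.\<close>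
  define d where "d = 1 / (2 ^ 20 * (K + 1))"
  have d: "0 < d" "d < 1" using assms by (auto simp: d_def field_simps)
  define \<theta> where "\<theta> = 1 - d"
  have \<theta>: "0 < \<theta>" "\<theta> < 1" using d by (auto simp: \<theta>_def)
  have "K * (\<integral>x. x \<partial>unit_uniform) \<le> K * 2"
    using mean_unit_uniform assms by (intro mult_left_mono) auto
  also have "\<dots> < (1 / 2) * (8 * (K + 1))" using assms by simp
  also have "\<dots> = (1 / 2) / (2 ^ 17 * d)" using assms by (simp add: d_def field_simps)
  also have "\<dots> \<le> (1 - \<theta> / 32) / (2 ^ 17 * d)"
    using d \<theta> by (intro divide_right_mono) auto
  also have "\<dots> = (\<integral>x. x \<partial>pareto \<theta>)" using mean_pareto[OF \<theta>] by (simp add: \<theta>_def)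
  finally have mean: "(\<integral>x. x \<partial>pareto \<theta>) > K * (\<integral>x. x \<partial>unit_uniform)" .
  have ge1: "AE x in unit_uniform. 1 \<le> x" using AE_unit_uniform by auto
  then have pos: "AE x in unit_uniform. 0 < x" by (rule AE_mp) auto
  have "blue_wins_almost_surely (pareto \<theta>) unit_uniform"
    by (rule blue_wins_almost_surelyI[OF real_distribution_pareto[OF \<theta>] pareto_positive[OF \<theta>]
          real_distribution_unit_uniform ge1 non_atomic_unit_uniform \<theta> pareto_tail[OF \<theta>]])
  moreover have "distribution_on_positive_reals (pareto \<theta>)"
    using real_distribution_pareto[OF \<theta>] pareto_positive[OF \<theta>]
    by (simp add: distribution_on_positive_reals_def)
  moreover have "distribution_on_positive_reals unit_uniform"
    using real_distribution_unit_uniform pos by (simp add: distribution_on_positive_reals_def)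
  ultimately show ?thesis
    using mean integrable_pareto[OF \<theta>] integrable_unit_uniform non_atomic_unit_uniform by blast
qed

end
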